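(* Isotopy classes of pseudo links in the solid torus (resp. in the thickened torus) are in bijection with isotopy classes of ${\rm O}$-mixed pseudo links (resp. ${\rm H}$-mixed pseudo links) in $S^3$, via isotopies that keep ${\rm O}$ (resp. ${\rm H}$) point-wise fixed.
   Context: Notation: $I=[0,1]$; $\mathcal{A}=S^1\times D^1$ is the annulus; $\mathcal{T}=S^1\times S^1$ is the torus; $\mathcal{A}\times I$ is homeomorphic to the solid torus; $\mathcal{T}\times I$ is the thickened torus. A planar (resp. annular, toroidal) pseudo link diagram is a regular knot or link diagram in the plane (resp. in the interior of $\mathcal{A}$, in the surface $\mathcal{T}$) in which some crossing information may be missing, i.e. at some double points, called precrossings, it is not known which strand passes over. The lift of a planar (resp. annular, toroidal) pseudo link diagram in three-space (or $S^3$) (resp. in $\mathcal{A}\times I$, in $\mathcal{T}\times I$) is defined as follows: every classical crossing is embedded in a sufficiently small 3-ball of the ambient space so that the over arc lies in its upper boundary and the under arc in its lower boundary; the precrossings are supported by sufficiently small rigid discs embedded in the ambient space; and the simple arcs connecting crossings can be replaced by isotopic ones. The result is a collection of closed curves in the interior of the ambient space consisting of embedded discs (precrossing discs) from which emanate embedded arcs; it is called a spatial pseudo link (resp. a pseudo link in the solid torus, a pseudo link in the thickened torus). Two such pseudo links in the same ambient space are isotopic if they are related by isotopies of arcs and discs (confined to the interior of the solid torus, resp. of the thickened torus, in these two cases). The solid torus is viewed as the complement in $S^3$ of another solid torus, which is represented by the standard unknot ${\rm O}$. The thickened torus is viewed as homeomorphic to the complement in $S^3$ of the Hopf link ${\rm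 H}$, whose two components are marked, say by $m$ and $l$. An ${\rm O}$-mixed pseudo link in $S^3$ is a spatial pseudo link ${\rm O}\cup K$ which contains the standard unknot ${\rm O}$ as a point-wise fixed sublink, the sublink $K$ resulting by removing ${\rm O}$ being called the moving part, such that there are no precrossing discs between the fixed and the moving part. An ${\rm H}$-mixed pseudo link in $S^3$ is a spatial pseudo link ${\rm H}\cup K$ which contains the marked Hopf link ${\rm H}$ as a point-wise fixed sublink, $K$ being the moving part, such that there are no precrossing discs between the fixed and the moving part. Isotopies of ${\rm O}$-mixed (resp. ${\rm H}$-mixed) pseudo links are isotopies of spatial pseudo links in $S^3$ that keep ${\rm O}$ (resp. ${\rm H}$) point-wise fixed. A pseudo link $K$ in the solid torus (resp. thickened torus) is represented by ${\rm O}\cup K$ (resp. ${\rm H}\cup K$) under the identification of the solid torus with the complement in $S^3$ of another solid torus, represented by the standard unknot ${\rm O}$ (resp. the identification of the thickened torus with the complement in $S^3$ of the marked Hopf link ${\rm H}$). *)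

theory Defs
  imports "HOL-Analysis.Analysis"
begin

section \<open>Pseudo links in an ambient space\<close>

text \<open>
  Everything takes place in the \<open>C\<^sup>1\<close> category.  An ambient space is a subset \<open>M\<close> of a Euclidean
  space: the open manifold in whose points the links have to lie.

  Curves are 1-periodic functions on the reals, discs are parametrised by the closed unit disc
  of the complex plane.
\<close>

definition regular_closed_curve :: "(real \<Rightarrow> 'a::real_normed_vector) \<Rightarrow> bool" where
  "regular_closed_curve c \<longleftrightarrow>
     (\<forall>s. c (s + 1) = c s) \<and> c C1_differentiable_on UNIV \<and> (\<forall>s. vector_derivative c (at s) \<noteq> 0)"

definition embedded_disc :: "(complex \<Rightarrow> 'a::real_normed_vector) \<Rightarrow> bool" where
  "embedded_disc d \<longleftrightarrow> inj_on d (cball 0 1) \<and>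
     (\<exists>d' :: complex \<Rightarrow> complex \<Rightarrow>\<^sub>L 'a. continuous_on (cball 0 1) d' \<and>
        (\<forall>z\<in>cball 0 1. (d has_derivative blinfun_apply (d' z)) (at z within cball 0 1) \<and>
                       inj (blinfun_apply (d' z))))"

text \<open>The pattern formed by the two strands of a precrossing inside its disc.\<close>

definition cross :: "complex set" where
  "cross = {z \<in> cball 0 1. Re z = 0 \<or> Im z = 0}"

text \<open>
  A parametrised pseudo link has \<open>n\<close> closed curves \<open>\<Gamma> 0, \<dots>, \<Gamma> (n - 1)\<close> and \<open>k\<close> precrossing discs
  \<open>\<Delta> 0, \<dots>, \<Delta> (k - 1)\<close>.  The curves are embedded except that exactly two strands meet at the centre
  of each disc; each disc meets the curves precisely in its two crossing strands, and arcs emanate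
  from the four end points of these.  Since the curves are \<open>C\<^sup>1\<close> and regular, a strand entering a disc
  necessarily goes straight through the centre.
\<close>

definition pseudo_link_param ::
  "'a::real_normed_vector set \<Rightarrow> nat \<Rightarrow> nat \<Rightarrow> (nat \<Rightarrow> real \<Rightarrow> 'a) \<Rightarrow> (nat \<Rightarrow> complex \<Rightarrow> 'a) \<Rightarrow> bool"
where
  "pseudo_link_param M n k \<Gamma> \<Delta> \<longleftrightarrow>
     0 < n \<and>
     (\<forall>j<n. regular_closed_curve (\<Gamma> j) \<and> range (\<Gamma> j) \<subseteq> M) \<and>
     (\<forall>i<k. embedded_disc (\<Delta> i) \<and> \<Delta> i ` cball 0 1 \<subseteq> M) \<and>
     disjoint_family_on (\<lambda>i. \<Delta> i ` cball 0 1) {..<k} \<and>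
     (\<forall>i<k. \<Delta> i ` cball 0 1 \<inter> (\<Union>j<n. range (\<Gamma> j)) = \<Delta> i ` cross) \<and>
     (\<forall>i<k. card {(j, s). j < n \<and> s \<in> {0..<1} \<and> \<Gamma> j s = \<Delta> i 0} = 2) \<and>
     inj_on (\<lambda>(j, s). \<Gamma> j s) {(j, s). j < n \<and> s \<in> {0..<1} \<and> \<Gamma> j s \<notin> (\<lambda>i. \<Delta> i 0) ` {..<k}}"

text \<open>
  A pseudo link is the unparametrised (unoriented, unordered) object: the set of its components
  together with the set of its precrossing discs.
\<close>

type_synonym 'a pseudo_link = "'a set set \<times> 'a set set"

definition pl_trace :: "nat \<Rightarrow> nat \<Rightarrow> (nat \<Rightarrow> real \<Rightarrow> 'a) \<Rightarrow> (nat \<Rightarrow> complex \<Rightarrow> 'a) \<Rightarrow> 'a pseudo_link" where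
  "pl_trace n k \<Gamma> \<Delta> = ((\<lambda>j. range (\<Gamma> j)) ` {..<n}, (\<lambda>i. \<Delta> i ` cball 0 1) ` {..<k})"

definition pseudo_links :: "'a::real_normed_vector set \<Rightarrow> 'a pseudo_link set" where
  "pseudo_links M = {P. \<exists>n k \<Gamma> \<Delta>. pseudo_link_param M n k \<Gamma> \<Delta> \<and> P = pl_trace n k \<Gamma> \<Delta>}"


section \<open>Isotopies of arcs and discs\<close>

text \<open>
  An isotopy is a path of parametrised pseudo links in \<open>M\<close>, continuous in the \<open>C\<^sup>1\<close> topology, i.e.
  such that the maps and their space derivatives depend continuously on time and position.
  (Mere continuity of the maps would allow knotted parts of arcs to be shrunk to points.)
\<close>

definition pl_isotopy ::
  "'a::real_normed_vector set \<Rightarrow> nat \<Rightarrow> nat \<Rightarrow>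
   (real \<Rightarrow> nat \<Rightarrow> real \<Rightarrow> 'a) \<Rightarrow> (real \<Rightarrow> nat \<Rightarrow> complex \<Rightarrow> 'a) \<Rightarrow> bool"
where
  "pl_isotopy M n k \<Gamma> \<Delta> \<longleftrightarrow>
     (\<forall>t\<in>{0..1}. pseudo_link_param M n k (\<Gamma> t) (\<Delta> t)) \<and>
     (\<forall>j<n. continuous_on ({0..1} \<times> UNIV) (\<lambda>(t, s). \<Gamma> t j s) \<and>
            continuous_on ({0..1} \<times> UNIV) (\<lambda>(t, s). vector_derivative (\<Gamma> t j) (at s))) \<and>
     (\<forall>i<k. continuous_on ({0..1} \<times> cball 0 1) (\<lambda>(t, z). \<Delta> t i z) \<and>
            (\<exists>d' :: real \<Rightarrow> complex \<Rightarrow> complex \<Rightarrow>\<^sub>L 'a.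
               continuous_on ({0..1} \<times> cball 0 1) (\<lambda>(t, z). d' t z) \<and>
               (\<forall>t\<in>{0..1}. \<forall>z\<in>cball 0 1.
                  (\<Delta> t i has_derivative blinfun_apply (d' t z)) (at z within cball 0 1))))"

text \<open>
  Two pseudo links are isotopic if they are related by finitely many successive isotopies; the
  transitive closure saves matching the parametrisations when isotopies are concatenated.
\<close>

definition isotopy_step :: "'a::real_normed_vector set \<Rightarrow> 'a pseudo_link rel" where
  "isotopy_step M = {(P, Q). \<exists>n k \<Gamma> \<Delta>. pl_isotopy M n k \<Gamma> \<Delta> \<and>
     P = pl_trace n k (\<Gamma> 0) (\<Delta> 0) \<and> Q = pl_trace n k (\<Gamma> 1) (\<Delta> 1)}"

definition isotopic :: "'a::real_normed_vector set \<Rightarrow> 'a pseudo_link rel" where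
  "isotopic M = (isotopy_step M)\<^sup>+"


lemma pl_isotopy_const:
  assumes "pseudo_link_param M n k \<Gamma> \<Delta>"
  shows "pl_isotopy M n k (\<lambda>_. \<Gamma>) (\<lambda>_. \<Delta>)"
proof -
  have 1: "continuous_on ({0..1} \<times> UNIV) (\<lambda>(t::real, s). f s)"
    if "continuous_on UNIV f" for f :: "real \<Rightarrow> 'a"
    unfolding split_beta by (rule continuous_on_compose2[OF that]) (auto intro!: continuous_intros)
  have 2: "continuous_on ({0..1} \<times> cball 0 1) (\<lambda>(t::real, z). f z)"
    if "continuous_on (cball 0 1) f" for f :: "complex \<Rightarrow> 'c::topological_space"
    unfolding split_beta by (rule continuous_on_compose2[OF that]) (auto intro!: continuous_intros)
  have c: "continuous_on UNIV (\<Gamma> j)" "continuous_on UNIV (\<lambda>s. vector_derivative (\<Gamma> j) (at s))"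
    if "j < n" for j
  proof -
    have d: "\<Gamma> j C1_differentiable_on UNIV"
      using assms that by (auto simp: pseudo_link_param_def regular_closed_curve_def)
    show "continuous_on UNIV (\<Gamma> j)" by (rule C1_differentiable_imp_continuous_on[OF d])
    show "continuous_on UNIV (\<lambda>s. vector_derivative (\<Gamma> j) (at s))"
      using d by (auto simp: C1_differentiable_on_eq)
  qed
  have d: "continuous_on (cball 0 1) (\<Delta> i) \<and> (\<exists>d' :: complex \<Rightarrow> complex \<Rightarrow>\<^sub>L 'a.
      continuous_on (cball 0 1) d' \<and>
        (\<forall>z\<in>cball 0 1. (\<Delta> i has_derivative blinfun_apply (d' z)) (at z within cball 0 1)))"
    if "i < k" for i
  proof -
    have "embedded_disc (\<Delta> i)" using assms that by (auto simp: pseudo_link_param_def)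
    then obtain d' :: "complex \<Rightarrow> complex \<Rightarrow>\<^sub>L 'a" where d': "continuous_on (cball 0 1) d'"
      "\<And>z. z \<in> cball 0 1 \<Longrightarrow> (\<Delta> i has_derivative blinfun_apply (d' z)) (at z within cball 0 1)"
      unfolding embedded_disc_def by blast
    have "continuous_on (cball 0 1) (\<Delta> i)"
      by (rule has_derivative_continuous_on[OF d'(2)])
    with d' show ?thesis by blast
  qed
  show ?thesis
    unfolding pl_isotopy_def
  proof (intro conjI allI impI ballI)
    fix i assume i: "i < k"
    show "continuous_on ({0..1} \<times> cball 0 1) (\<lambda>(t::real, z). \<Delta> i z)" by (rule 2[OF conjunct1[OF d[OF i]]])
    from d[OF i] obtain d' :: "complex \<Rightarrow> complex \<Rightarrow>\<^sub>L 'a" where d': "continuous_on (cball 0 1) d'"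
      "\<And>z. z \<in> cball 0 1 \<Longrightarrow> (\<Delta> i has_derivative blinfun_apply (d' z)) (at z within cball 0 1)"
      by blast
    show "\<exists>d' :: real \<Rightarrow> complex \<Rightarrow> complex \<Rightarrow>\<^sub>L 'a.
               continuous_on ({0..1} \<times> cball 0 1) (\<lambda>(t, z). d' t z) \<and>
               (\<forall>t\<in>{0..1}. \<forall>z\<in>cball 0 1.
                  (\<Delta> i has_derivative blinfun_apply (d' t z)) (at z within cball 0 1))"
      using d'(2) 2[OF d'(1)] by (intro exI[of _ "\<lambda>_. d'"]) blast
  next
    fix j assume "j < n"
    note cj = c[OF this]
    show "continuous_on ({0..1} \<times> UNIV) (\<lambda>(t::real, s). \<Gamma> j s)" by (rule 1[OF cj(1)])
    show "continuous_on ({0..1} \<times> UNIV) (\<lambda>(t::real, s). vector_derivative (\<Gamma> j) (at s))"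
      by (rule 1[OF cj(2)])
  qed (rule assms)
qed

lemma pl_isotopy_reverse:
  assumes "pl_isotopy M n k \<Gamma> \<Delta>"
  shows "pl_isotopy M n k (\<lambda>t. \<Gamma> (1 - t)) (\<lambda>t. \<Delta> (1 - t))"
proof -
  have rev: "continuous_on ({0..1} \<times> S) (\<lambda>(t, s). f (1 - t) s)"
    if "continuous_on ({0..1} \<times> S) (\<lambda>(t, s). f t s)"
    for f :: "real \<Rightarrow> 'b::topological_space \<Rightarrow> 'c::topological_space" and S
  proof -
    have "continuous_on ({0..1} \<times> S) ((\<lambda>(t, s). f t s) \<circ> (\<lambda>p. (1 - fst p, snd p)))"
      by (intro continuous_on_compose continuous_intros continuous_on_subset[OF that]) auto
    then show ?thesis by (simp add: o_def split_beta)
  qed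
  show ?thesis
    unfolding pl_isotopy_def
  proof (intro conjI allI impI ballI)
    fix i assume i: "i < k"
    show "continuous_on ({0..1} \<times> cball 0 1) (\<lambda>(t, z). \<Delta> (1 - t) i z)"
      by (rule rev[of _ "\<lambda>t. \<Delta> t i"]) (use assms i in \<open>auto simp: pl_isotopy_def\<close>)
    obtain d' :: "real \<Rightarrow> complex \<Rightarrow> complex \<Rightarrow>\<^sub>L 'a" where d':
      "continuous_on ({0..1} \<times> cball 0 1) (\<lambda>(t, z). d' t z)"
      "\<And>t z. t \<in> {0..1} \<Longrightarrow> z \<in> cball 0 1 \<Longrightarrow>
        (\<Delta> t i has_derivative blinfun_apply (d' t z)) (at z within cball 0 1)"
      using assms i unfolding pl_isotopy_def by blast
    show "\<exists>d' :: real \<Rightarrow> complex \<Rightarrow> complex \<Rightarrow>\<^sub>L 'a.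
               continuous_on ({0..1} \<times> cball 0 1) (\<lambda>(t, z). d' t z) \<and>
               (\<forall>t\<in>{0..1}. \<forall>z\<in>cball 0 1.
                  (\<Delta> (1 - t) i has_derivative blinfun_apply (d' t z)) (at z within cball 0 1))"
      by (intro exI[of _ "\<lambda>t. d' (1 - t)"] conjI rev[OF d'(1)] ballI d'(2)) auto
  next
    fix j assume j: "j < n"
    show "continuous_on ({0..1} \<times> UNIV) (\<lambda>(t, s). \<Gamma> (1 - t) j s)"
      by (rule rev[of _ "\<lambda>t. \<Gamma> t j"]) (use assms j in \<open>auto simp: pl_isotopy_def\<close>)
    show "continuous_on ({0..1} \<times> UNIV) (\<lambda>(t, s). vector_derivative (\<Gamma> (1 - t) j) (at s))"
      by (rule rev[of _ "\<lambda>t s. vector_derivative (\<Gamma> t j) (at s)"])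
        (use assms j in \<open>auto simp: pl_isotopy_def\<close>)
  qed (use assms in \<open>auto simp: pl_isotopy_def\<close>)
qed

lemma equiv_trancl:
  assumes "R \<subseteq> A \<times> A" "\<And>x. x \<in> A \<Longrightarrow> (x, x) \<in> R" "sym R"
  shows "equiv A (R\<^sup>+)"
proof (rule equivI)
  show "R\<^sup>+ \<subseteq> A \<times> A" by (rule trancl_subset_Sigma[OF assms(1)])
  show "refl_on A (R\<^sup>+)" using assms(2) by (auto simp: refl_on_def)
  show "sym (R\<^sup>+)" by (rule sym_trancl[OF assms(3)])
  show "trans (R\<^sup>+)" by (rule trans_trancl)
qed

theorem equiv_isotopic: "equiv (pseudo_links M) (isotopic M)"
  unfolding isotopic_def
proof (rule equiv_trancl)
  have "pl_trace n k (\<Gamma> t) (\<Delta> t) \<in> pseudo_links M"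
    if "pl_isotopy M n k \<Gamma> \<Delta>" "t \<in> {0..1}" for n k \<Gamma> \<Delta> t
    using that unfolding pseudo_links_def pl_isotopy_def by blast
  then show "isotopy_step M \<subseteq> pseudo_links M \<times> pseudo_links M"
    by (auto simp: isotopy_step_def)
next
  fix P assume "P \<in> pseudo_links M"
  then obtain n k \<Gamma> \<Delta> where "pseudo_link_param M n k \<Gamma> \<Delta>" "P = pl_trace n k \<Gamma> \<Delta>"
    by (auto simp: pseudo_links_def)
  with pl_isotopy_const[OF this(1)] show "(P, P) \<in> isotopy_step M"
    unfolding isotopy_step_def by blast
next
  show "sym (isotopy_step M)"
  proof (rule symI)
    fix P Q assume "(P, Q) \<in> isotopy_step M"
    then obtain n k \<Gamma> \<Delta> where iso: "pl_isotopy M n k \<Gamma> \<Delta>"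
      and PQ: "P = pl_trace n k (\<Gamma> 0) (\<Delta> 0)" "Q = pl_trace n k (\<Gamma> 1) (\<Delta> 1)"
      by (auto simp: isotopy_step_def)
    show "(Q, P) \<in> isotopy_step M"
      unfolding isotopy_step_def mem_Collect_eq case_prod_conv
      by (rule exI[of _ n], rule exI[of _ k], rule exI[of _ "\<lambda>t. \<Gamma> (1 - t)"],
          rule exI[of _ "\<lambda>t. \<Delta> (1 - t)"])
        (use pl_isotopy_reverse[OF iso] PQ in simp)
  qed
qed


section \<open>Mixed pseudo links in the 3-sphere\<close>

definition S3 :: "(complex \<times> complex) set" where
  "S3 = sphere 0 1"

text \<open>\<open>\<F>\<close> is the set of components of the fixed part; the moving part has to be nonempty.\<close>

definition mixed_pseudo_links ::
  "(complex \<times> complex) set set \<Rightarrow> (complex \<times> complex) pseudo_link set" where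
  "mixed_pseudo_links \<F> = {(\<C>, \<D>). (\<C>, \<D>) \<in> pseudo_links S3 \<and> \<F> \<subset> \<C> \<and>
     (\<forall>D\<in>\<D>. \<not> (D \<inter> \<Union>\<F> \<noteq> {} \<and> D \<inter> \<Union>(\<C> - \<F>) \<noteq> {}))}"

definition mixed_isotopy_step ::
  "(complex \<times> complex) set set \<Rightarrow> (complex \<times> complex) pseudo_link rel" where
  "mixed_isotopy_step \<F> = {(P, Q). \<exists>n k \<Gamma> \<Delta>. pl_isotopy S3 n k \<Gamma> \<Delta> \<and>
      (\<forall>t\<in>{0..1}. pl_trace n k (\<Gamma> t) (\<Delta> t) \<in> mixed_pseudo_links \<F>) \<and>
      (\<forall>j<n. range (\<Gamma> 0 j) \<in> \<F> \<longrightarrow> (\<forall>t\<in>{0..1}. \<forall>s. \<Gamma> t j s = \<Gamma> 0 j s)) \<and>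
      P = pl_trace n k (\<Gamma> 0) (\<Delta> 0) \<and> Q = pl_trace n k (\<Gamma> 1) (\<Delta> 1)}"

definition mixed_isotopic ::
  "(complex \<times> complex) set set \<Rightarrow> (complex \<times> complex) pseudo_link rel" where
  "mixed_isotopic \<F> = (mixed_isotopy_step \<F>)\<^sup>+"

lemma regular_closed_curve_frac:
  assumes "regular_closed_curve c"
  shows "c (frac s) = c s"
proof -
  have per: "c (s + 1) = c s" for s using assms by (simp add: regular_closed_curve_def)
  have nat: "c (s + real m) = c s" for s m
  proof (induction m)
    case (Suc m)
    show ?case using per[of "s + real m"] Suc by (simp add: algebra_simps)
  qed auto
  have "c (frac s + of_int \<lfloor>s\<rfloor>) = c (frac s)"
  proof (cases "\<lfloor>s\<rfloor> \<ge> 0")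
    case True
    then show ?thesis using nat[of "frac s" "nat \<lfloor>s\<rfloor>"] by simp
  next
    case False
    then show ?thesis using nat[of "frac s + of_int \<lfloor>s\<rfloor>" "nat (- \<lfloor>s\<rfloor>)"] by simp
  qed
  then show ?thesis by (simp add: frac_def)
qed

lemma pseudo_link_param_components_distinct:
  fixes M :: "'a::real_normed_vector set"
  assumes p: "pseudo_link_param M n k \<Gamma> \<Delta>" and j: "i < n" "j < n"
    and eq: "range (\<Gamma> i) = range (\<Gamma> j)"
  shows "i = j"
proof (rule ccontr)
  assume ne: "i \<noteq> j"
  have reg: "regular_closed_curve (\<Gamma> i)" "regular_closed_curve (\<Gamma> j)"
    using p j by (auto simp: pseudo_link_param_def)
  have inj: "inj_on (\<lambda>(j, s). \<Gamma> j s)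
      {(j, s). j < n \<and> s \<in> {0..<1} \<and> \<Gamma> j s \<notin> (\<lambda>i. \<Delta> i 0) ` {..<k}}"
    using p by (simp add: pseudo_link_param_def)
  have sub: "range (\<Gamma> i) \<subseteq> (\<lambda>i. \<Delta> i 0) ` {..<k}"
  proof (rule ccontr)
    assume "\<not> ?thesis"
    then obtain s where s: "\<Gamma> i s \<notin> (\<lambda>i. \<Delta> i 0) ` {..<k}" by blast
    obtain s' where s': "\<Gamma> i s = \<Gamma> j s'" using eq by blast
    have fr: "frac s \<in> {0..<1}" "frac s' \<in> {0..<1}" by (auto simp: frac_lt_1)
    have 1: "\<Gamma> i (frac s) = \<Gamma> i s" by (rule regular_closed_curve_frac[OF reg(1)])
    have 2: "\<Gamma> j (frac s') = \<Gamma> i s" using regular_closed_curve_frac[OF reg(2)] s' by metis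
    have "(i, frac s) = (j, frac s')"
      by (rule inj_onD[OF inj]) (use 1 2 s fr j in auto)
    with ne show False by simp
  qed
  have C1: "\<Gamma> i C1_differentiable_on UNIV" using reg by (simp add: regular_closed_curve_def)
  have "connected (range (\<Gamma> i))"
    by (intro connected_continuous_image C1_differentiable_imp_continuous_on[OF C1]) simp
  moreover have "finite (range (\<Gamma> i))" using sub by (rule finite_subset) simp
  ultimately have "range (\<Gamma> i) = {} \<or> (\<exists>x. range (\<Gamma> i) = {x})"
    by (metis connected_finite_iff_sing)
  then obtain x where "range (\<Gamma> i) = {x}" by auto
  then have "\<Gamma> i = (\<lambda>_. x)" by auto
  then have "vector_derivative (\<Gamma> i) (at 0) = 0" by simp
  with reg show False by (simp add: regular_closed_curve_def)
qed

theorem equiv_mixed_isotopic: "equiv (mixed_pseudo_links \<F>) (mixed_isotopic \<F>)"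
  unfolding mixed_isotopic_def
proof (rule equiv_trancl)
  show "mixed_isotopy_step \<F> \<subseteq> mixed_pseudo_links \<F> \<times> mixed_pseudo_links \<F>"
    by (auto simp: mixed_isotopy_step_def)
next
  fix P assume P: "P \<in> mixed_pseudo_links \<F>"
  then have "P \<in> pseudo_links S3" by (auto simp: mixed_pseudo_links_def)
  then obtain n k \<Gamma> \<Delta> where p: "pseudo_link_param S3 n k \<Gamma> \<Delta>" "P = pl_trace n k \<Gamma> \<Delta>"
    by (auto simp: pseudo_links_def)
  show "(P, P) \<in> mixed_isotopy_step \<F>"
    unfolding mixed_isotopy_step_def mem_Collect_eq case_prod_conv
    by (rule exI[of _ n], rule exI[of _ k], rule exI[of _ "\<lambda>_. \<Gamma>"], rule exI[of _ "\<lambda>_. \<Delta>"])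
      (use pl_isotopy_const[OF p(1)] P p(2) in simp)
next
  show "sym (mixed_isotopy_step \<F>)"
  proof (rule symI)
    fix P Q assume "(P, Q) \<in> mixed_isotopy_step \<F>"
    then obtain n k \<Gamma> \<Delta> where iso: "pl_isotopy S3 n k \<Gamma> \<Delta>"
      and mix: "\<forall>t\<in>{0..1}. pl_trace n k (\<Gamma> t) (\<Delta> t) \<in> mixed_pseudo_links \<F>"
      and fixd: "\<forall>j<n. range (\<Gamma> 0 j) \<in> \<F> \<longrightarrow> (\<forall>t\<in>{0..1}. \<forall>s. \<Gamma> t j s = \<Gamma> 0 j s)"
      and PQ: "P = pl_trace n k (\<Gamma> 0) (\<Delta> 0)" "Q = pl_trace n k (\<Gamma> 1) (\<Delta> 1)"
      unfolding mixed_isotopy_step_def by blast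
    have fixd': "\<forall>t\<in>{0..1}. \<forall>s. \<Gamma> (1 - t) j s = \<Gamma> 1 j s"
      if j: "j < n" and r: "range (\<Gamma> 1 j) \<in> \<F>" for j
    proof -
      have "\<F> \<subseteq> fst (pl_trace n k (\<Gamma> 0) (\<Delta> 0))"
        using bspec[OF mix, of 0] by (auto simp: mixed_pseudo_links_def)
      with r obtain i where i: "i < n" "range (\<Gamma> 1 j) = range (\<Gamma> 0 i)"
        by (auto simp: pl_trace_def)
      have const: "\<Gamma> t i = \<Gamma> 0 i" if "t \<in> {0..1}" for t
      proof -
        have "range (\<Gamma> 0 i) \<in> \<F>" using r i(2) by simp
        then have "\<forall>t\<in>{0..1}. \<forall>s. \<Gamma> t i s = \<Gamma> 0 i s" using fixd i(1) by blast
        then show ?thesis using that by (intro ext) blast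
      qed
      have "range (\<Gamma> 1 i) = range (\<Gamma> 1 j)" using const[of 1] i(2) by simp
      moreover have "pseudo_link_param S3 n k (\<Gamma> 1) (\<Delta> 1)"
        by (rule bspec[OF conjunct1[OF iso[unfolded pl_isotopy_def]]]) simp
      ultimately have ij: "i = j" using i(1) j by (intro pseudo_link_param_components_distinct)
      have "\<Gamma> (1 - t) j = \<Gamma> 1 j" if "t \<in> {0..1}" for t
        using const[of "1 - t"] const[of 1] that unfolding ij by simp
      then show ?thesis by simp
    qed
    show "(Q, P) \<in> mixed_isotopy_step \<F>"
      unfolding mixed_isotopy_step_def mem_Collect_eq case_prod_conv
      by (rule exI[of _ n], rule exI[of _ k], rule exI[of _ "\<lambda>t. \<Gamma> (1 - t)"],
          rule exI[of _ "\<lambda>t. \<Delta> (1 - t)"])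
        (intro conjI allI impI pl_isotopy_reverse[OF iso] ballI bspec[OF mix];
         use PQ fixd' in \<open>simp only: diff_0_right diff_self atLeastAtMost_iff; linarith?\<close>)
  qed
qed

definition unknot :: "(complex \<times> complex) set" where
  "unknot = {p \<in> S3. snd p = 0}"

definition hopf_m :: "(complex \<times> complex) set" where
  "hopf_m = {p \<in> S3. snd p = 0}"

definition hopf_l :: "(complex \<times> complex) set" where
  "hopf_l = {p \<in> S3. fst p = 0}"

text \<open>The solid torus represented by the unknot: a closed tubular neighbourhood of it.\<close>

definition unknot_nbhd :: "real \<Rightarrow> (complex \<times> complex) set" where
  "unknot_nbhd r = {p \<in> S3. norm (snd p) \<le> r}"


section \<open>The solid torus and the thickened torus\<close>

text \<open>
  Manifold interiors of \<open>(S\<^sup>1 \<times> D\<^sup>1) \<times> I\<close> and \<open>(S\<^sup>1 \<times> S\<^sup>1) \<times> I\<close>, where \<open>D\<^sup>1 = [-1, 1]\<close> and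
  \<open>I = [0, 1]\<close>.  (The topological interior relative to the surrounding vector space is empty.)
\<close>

definition int_solid_torus :: "((complex \<times> real) \<times> real) set" where
  "int_solid_torus = (sphere 0 1 \<times> {-1<..<1}) \<times> {0<..<1}"

definition int_thickened_torus :: "((complex \<times> complex) \<times> real) set" where
  "int_thickened_torus = (sphere 0 1 \<times> sphere 0 1) \<times> {0<..<1}"

text \<open>\<open>C\<^sup>1\<close> maps on arbitrary subsets, as usual, are restrictions of \<open>C\<^sup>1\<close> maps on open sets.\<close>

definition C1_map :: "'a::real_normed_vector set \<Rightarrow> ('a \<Rightarrow> 'b::real_normed_vector) \<Rightarrow> bool" where
  "C1_map X f \<longleftrightarrow> (\<exists>U F. \<exists>F' :: 'a \<Rightarrow> 'a \<Rightarrow>\<^sub>L 'b. open U \<and> X \<subseteq> U \<and> (\<forall>x\<in>X. F x = f x) \<and>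
     (\<forall>x\<in>U. (F has_derivative blinfun_apply (F' x)) (at x)) \<and> continuous_on U F')"

definition C1_diffeo ::
  "'a::real_normed_vector set \<Rightarrow> 'b::real_normed_vector set \<Rightarrow> ('a \<Rightarrow> 'b) \<Rightarrow> bool" where
  "C1_diffeo X Y f \<longleftrightarrow> bij_betw f X Y \<and> C1_map X f \<and> C1_map Y (inv_into X f)"

text \<open>
  The mixed pseudo link \<open>F \<union> h(K)\<close> representing \<open>K\<close>, where \<open>h\<close> identifies the ambient space of \<open>K\<close>
  with a complement in the 3-sphere.
\<close>

definition mixed_representation :: "'b set set \<Rightarrow> ('a \<Rightarrow> 'b) \<Rightarrow> 'a pseudo_link \<Rightarrow> 'b pseudo_link" where
  "mixed_representation \<F> h = (\<lambda>(\<C>, \<D>). (\<F> \<union> image h ` \<C>, image h ` \<D>))"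

text \<open>
  The map on classes induced by \<open>f\<close>.  Its value is a single class of \<open>R\<close> precisely if \<open>f\<close> sends all
  elements of \<open>c\<close> to the same class.
\<close>

definition class_map :: "'b rel \<Rightarrow> ('a \<Rightarrow> 'b) \<Rightarrow> 'a set \<Rightarrow> 'b set" where
  "class_map R f c = R `` (f ` c)"


section \<open>The identifications exist\<close>

definition C1_open :: "'a::real_normed_vector set \<Rightarrow> ('a \<Rightarrow> 'b::real_normed_vector) \<Rightarrow> bool" where
  "C1_open U f \<longleftrightarrow> (\<exists>f'. (\<forall>x\<in>U. (f has_derivative f' x) (at x)) \<and>
                        (\<forall>v. continuous_on U (\<lambda>x. f' x v)))"

lemma C1_map_if_C1_open:
  fixes f :: "'a::euclidean_space \<Rightarrow> 'b::real_normed_vector"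
  assumes "C1_open U F" "open U" "X \<subseteq> U" "\<And>x. x \<in> X \<Longrightarrow> F x = f x"
  shows "C1_map X f"
proof -
  obtain F' where F': "\<And>x. x \<in> U \<Longrightarrow> (F has_derivative F' x) (at x)"
    "\<And>v. continuous_on U (\<lambda>x. F' x v)"
    using assms(1) unfolding C1_open_def by blast
  have app: "blinfun_apply (Blinfun (F' x)) = F' x" if "x \<in> U" for x
    by (rule bounded_linear_Blinfun_apply) (use F'(1)[OF that] in \<open>simp add: has_derivative_bounded_linear\<close>)
  have "continuous_on U (\<lambda>x. Blinfun (F' x))"
  proof (rule continuous_on_blinfun_componentwise)
    show "continuous_on U (\<lambda>x. blinfun_apply (Blinfun (F' x)) i)" for i
      using F'(2)[of i] app by (simp cong: continuous_on_cong)
  qed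
  then show ?thesis
    unfolding C1_map_def using assms F'(1) app
    by (intro exI[of _ U] exI[of _ F] exI[of _ "\<lambda>x. Blinfun (F' x)"]) auto
qed

lemma C1_open_continuous_on: "C1_open U f \<Longrightarrow> continuous_on U f"
  unfolding C1_open_def
  by (metis has_derivative_at_withinI has_derivative_continuous_on)

lemma C1_open_linear:
  assumes "bounded_linear L" "C1_open U f"
  shows "C1_open U (\<lambda>x. L (f x))"
proof -
  obtain f' where f': "\<And>x. x \<in> U \<Longrightarrow> (f has_derivative f' x) (at x)"
    "\<And>v. continuous_on U (\<lambda>x. f' x v)"
    using assms(2) unfolding C1_open_def by blast
  show ?thesis unfolding C1_open_def
    by (intro exI[of _ "\<lambda>x v. L (f' x v)"] conjI ballI allI bounded_linear.has_derivative[OF assms(1)]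
        bounded_linear.continuous_on[OF assms(1)] f')
qed

lemma C1_open_ident: "C1_open U (\<lambda>x. x)"
  unfolding C1_open_def by (intro exI[of _ "\<lambda>x v. v"]) auto

lemma C1_open_const: "C1_open U (\<lambda>x. c)"
  unfolding C1_open_def by (intro exI[of _ "\<lambda>x v. 0"]) auto

lemma C1_open_Pair:
  assumes "C1_open U f" "C1_open U g"
  shows "C1_open U (\<lambda>x. (f x, g x))"
proof -
  obtain f' where f': "\<And>x. x \<in> U \<Longrightarrow> (f has_derivative f' x) (at x)"
    "\<And>v. continuous_on U (\<lambda>x. f' x v)"
    using assms(1) unfolding C1_open_def by blast
  obtain g' where g': "\<And>x. x \<in> U \<Longrightarrow> (g has_derivative g' x) (at x)"
    "\<And>v. continuous_on U (\<lambda>x. g' x v)"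
    using assms(2) unfolding C1_open_def by blast
  show ?thesis unfolding C1_open_def
    by (intro exI[of _ "\<lambda>x v. (f' x v, g' x v)"] conjI ballI allI has_derivative_Pair
        continuous_on_Pair f' g')
qed

lemma C1_open_add:
  assumes "C1_open U f" "C1_open U g"
  shows "C1_open U (\<lambda>x. f x + g x)"
proof -
  obtain f' where f': "\<And>x. x \<in> U \<Longrightarrow> (f has_derivative f' x) (at x)"
    "\<And>v. continuous_on U (\<lambda>x. f' x v)"
    using assms(1) unfolding C1_open_def by blast
  obtain g' where g': "\<And>x. x \<in> U \<Longrightarrow> (g has_derivative g' x) (at x)"
    "\<And>v. continuous_on U (\<lambda>x. g' x v)"
    using assms(2) unfolding C1_open_def by blast
  show ?thesis unfolding C1_open_def
    by (intro exI[of _ "\<lambda>x v. f' x v + g' x v"] conjI ballI allI has_derivative_add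
        continuous_on_add f' g')
qed

lemma C1_open_scaleR:
  assumes "C1_open U f" "C1_open U g"
  shows "C1_open U (\<lambda>x. f x *\<^sub>R g x)"
proof -
  obtain f' where f': "\<And>x. x \<in> U \<Longrightarrow> (f has_derivative f' x) (at x)"
    "\<And>v. continuous_on U (\<lambda>x. f' x v)"
    using assms(1) unfolding C1_open_def by blast
  obtain g' where g': "\<And>x. x \<in> U \<Longrightarrow> (g has_derivative g' x) (at x)"
    "\<And>v. continuous_on U (\<lambda>x. g' x v)"
    using assms(2) unfolding C1_open_def by blast
  show ?thesis unfolding C1_open_def
    by (intro exI[of _ "\<lambda>x v. f x *\<^sub>R g' x v + f' x v *\<^sub>R g x"] conjI ballI allI has_derivative_scaleR
        continuous_intros C1_open_continuous_on assms f' g')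
qed

lemma C1_open_real:
  fixes f :: "'a::real_normed_vector \<Rightarrow> real"
  assumes "C1_open U f" "\<And>y. y \<in> S \<Longrightarrow> (\<phi> has_real_derivative \<phi>' y) (at y)"
    "continuous_on S \<phi>'" "f ` U \<subseteq> S"
  shows "C1_open U (\<lambda>x. \<phi> (f x))"
proof -
  obtain f' where f': "\<And>x. x \<in> U \<Longrightarrow> (f has_derivative f' x) (at x)"
    "\<And>v. continuous_on U (\<lambda>x. f' x v)"
    using assms(1) unfolding C1_open_def by blast
  have "((\<lambda>x. \<phi> (f x)) has_derivative (\<lambda>v. \<phi>' (f x) * f' x v)) (at x)" if "x \<in> U" for x
  proof -
    have "(\<phi> has_derivative (*) (\<phi>' (f x))) (at (f x))"
      using assms(2)[of "f x"] assms(4) that by (auto simp: has_field_derivative_def)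
    from has_derivative_compose[OF f'(1)[OF that] this] show ?thesis .
  qed
  moreover have "continuous_on U (\<lambda>x. \<phi>' (f x))"
    by (rule continuous_on_compose2[OF assms(3) C1_open_continuous_on[OF assms(1)] assms(4)])
  ultimately show ?thesis unfolding C1_open_def
    by (intro exI[of _ "\<lambda>x v. \<phi>' (f x) * f' x v"]) (auto intro!: continuous_intros f'(2))
qed

lemma C1_open_mult:
  fixes f g :: "'a::real_normed_vector \<Rightarrow> real"
  shows "C1_open U f \<Longrightarrow> C1_open U g \<Longrightarrow> C1_open U (\<lambda>x. f x * g x)"
  using C1_open_scaleR[of U f g] by simp

lemma C1_open_linears:
  "C1_open U f \<Longrightarrow> C1_open U (\<lambda>x. fst (f x))"
  "C1_open U f \<Longrightarrow> C1_open U (\<lambda>x. snd (f x))"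
  "C1_open U z \<Longrightarrow> C1_open U (\<lambda>x. Re (z x))"
  "C1_open U z \<Longrightarrow> C1_open U (\<lambda>x. Im (z x))"
  "C1_open U y \<Longrightarrow> C1_open U (\<lambda>x. - y x)"
  by (rule C1_open_linear; simp add: bounded_linear_fst bounded_linear_snd bounded_linear_Re
      bounded_linear_Im bounded_linear_minus[OF bounded_linear_ident])+

lemma C1_open_inverse:
  fixes f :: "'a::real_normed_vector \<Rightarrow> real"
  assumes "C1_open U f" "\<And>x. x \<in> U \<Longrightarrow> f x \<noteq> 0"
  shows "C1_open U (\<lambda>x. inverse (f x))"
  by (rule C1_open_real[OF assms(1), where S = "-{0}" and \<phi>' = "\<lambda>y. - (inverse y * inverse y)"])
    (use assms(2) in \<open>auto intro!: derivative_eq_intros continuous_intros\<close>)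

lemma C1_open_sqrt:
  fixes f :: "'a::real_normed_vector \<Rightarrow> real"
  assumes "C1_open U f" "\<And>x. x \<in> U \<Longrightarrow> f x > 0"
  shows "C1_open U (\<lambda>x. sqrt (f x))"
  by (rule C1_open_real[OF assms(1), where S = "{0<..}" and \<phi>' = "\<lambda>y. inverse (sqrt y) / 2"])
    (use assms(2) in \<open>auto intro!: DERIV_real_sqrt continuous_intros\<close>)

lemma C1_open_arctan:
  fixes f :: "'a::real_normed_vector \<Rightarrow> real"
  assumes "C1_open U f"
  shows "C1_open U (\<lambda>x. arctan (f x))"
  by (rule C1_open_real[OF assms(1), where S = UNIV and \<phi>' = "\<lambda>y. inverse (1 + y\<^sup>2)"])
    (auto intro!: DERIV_arctan continuous_intros simp: add_nonneg_eq_0_iff)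

lemma C1_open_tan:
  fixes f :: "'a::real_normed_vector \<Rightarrow> real"
  assumes "C1_open U f" "\<And>x. x \<in> U \<Longrightarrow> cos (f x) \<noteq> 0"
  shows "C1_open U (\<lambda>x. tan (f x))"
  by (rule C1_open_real[OF assms(1), where S = "{y. cos y \<noteq> 0}" and \<phi>' = "\<lambda>y. inverse ((cos y)\<^sup>2)"])
    (use assms(2) in \<open>auto intro!: DERIV_tan continuous_intros\<close>)

lemma C1_open_sin_cos:
  fixes f :: "'a::real_normed_vector \<Rightarrow> real"
  assumes "C1_open U f"
  shows "C1_open U (\<lambda>x. sin (f x))" "C1_open U (\<lambda>x. cos (f x))"
  using C1_open_real[OF assms(1), where S = UNIV and \<phi> = sin and \<phi>' = cos]
    C1_open_real[OF assms(1), where S = UNIV and \<phi> = cos and \<phi>' = "\<lambda>y. - sin y"]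
  by (simp_all add: continuous_intros DERIV_sin DERIV_cos)

lemma C1_open_norm_complex:
  fixes f :: "'a::real_normed_vector \<Rightarrow> complex"
  assumes "C1_open U f" "\<And>x. x \<in> U \<Longrightarrow> f x \<noteq> 0"
  shows "C1_open U (\<lambda>x. norm (f x))"
proof -
  have "C1_open U (\<lambda>x. sqrt (Re (f x) * Re (f x) + Im (f x) * Im (f x)))"
  proof (intro C1_open_sqrt C1_open_add C1_open_mult C1_open_linears assms)
    fix x assume "x \<in> U"
    then have "f x \<noteq> 0" using assms by simp
    then show "0 < Re (f x) * Re (f x) + Im (f x) * Im (f x)"
      by (metis complex_neq_0 power2_eq_square)
  qed
  then show ?thesis by (simp add: cmod_def power2_eq_square)
qed

lemma C1_open_norm2_complex:
  fixes f :: "'a::real_normed_vector \<Rightarrow> complex"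
  assumes "C1_open U f"
  shows "C1_open U (\<lambda>x. (norm (f x))\<^sup>2)"
proof -
  have "C1_open U (\<lambda>x. Re (f x) * Re (f x) + Im (f x) * Im (f x))"
    by (intro C1_open_add C1_open_mult C1_open_linears assms)
  then show ?thesis by (simp add: cmod_power2 flip: power2_eq_square)
qed

lemma C1_open_Complex:
  assumes "C1_open U f" "C1_open U g"
  shows "C1_open U (\<lambda>x. Complex (f x) (g x))"
proof -
  have "C1_open U (\<lambda>x. f x *\<^sub>R 1 + g x *\<^sub>R \<i>)"
    by (intro C1_open_add C1_open_scaleR C1_open_const assms)
  moreover have "f x *\<^sub>R 1 + g x *\<^sub>R \<i> = Complex (f x) (g x)" for x
    by (simp add: complex_eq_iff)
  ultimately show ?thesis by simp
qed

lemmas C1_open_intros = C1_open_ident C1_open_const C1_open_Pair C1_open_add C1_open_scaleR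
  C1_open_mult C1_open_linears C1_open_inverse C1_open_sqrt C1_open_arctan C1_open_tan
  C1_open_sin_cos C1_open_norm2_complex C1_open_norm_complex C1_open_Complex

lemma C1_diffeoI:
  fixes f :: "'a::euclidean_space \<Rightarrow> 'b::euclidean_space"
  assumes "C1_open U f" "open U" "X \<subseteq> U" "C1_open V g" "open V" "Y \<subseteq> V"
    and "\<And>x. x \<in> X \<Longrightarrow> f x \<in> Y" "\<And>y. y \<in> Y \<Longrightarrow> g y \<in> X"
    and "\<And>x. x \<in> X \<Longrightarrow> g (f x) = x" "\<And>y. y \<in> Y \<Longrightarrow> f (g y) = y"
  shows "C1_diffeo X Y f"
proof -
  have bij: "bij_betw f X Y"
    by (rule bij_betw_byWitness[where f' = g]) (use assms in auto)
  have "g y = inv_into X f y" if "y \<in> Y" for y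
    by (metis that assms(8,10) bij bij_betw_inv_into_left)
  then have "C1_map Y (inv_into X f)"
    by (intro C1_map_if_C1_open[OF assms(4-6)])
  moreover have "C1_map X f" by (intro C1_map_if_C1_open[OF assms(1-3)]) simp
  ultimately show ?thesis using bij by (simp add: C1_diffeo_def)
qed

lemma mem_S3: "p \<in> S3 \<longleftrightarrow> (norm (fst p))\<^sup>2 + (norm (snd p))\<^sup>2 = 1"
  by (simp add: S3_def norm_prod_def)

theorem ex_thickened_torus_identification:
  "\<exists>g. C1_diffeo int_thickened_torus (S3 - (hopf_m \<union> hopf_l)) g"
proof -
  define f :: "(complex \<times> complex) \<times> real \<Rightarrow> complex \<times> complex" where
    "f = (\<lambda>x. (cos (pi / 2 * snd x) *\<^sub>R fst (fst x), sin (pi / 2 * snd x) *\<^sub>R snd (fst x)))"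
  define g :: "complex \<times> complex \<Rightarrow> (complex \<times> complex) \<times> real" where
    "g = (\<lambda>p. ((inverse (norm (fst p)) *\<^sub>R fst p, inverse (norm (snd p)) *\<^sub>R snd p),
               2 / pi * arctan (norm (snd p) * inverse (norm (fst p)))))"
  let ?V = "{p :: complex \<times> complex. fst p \<noteq> 0} \<inter> {p. snd p \<noteq> 0}"
  have X: "norm (fst (fst x)) = 1" "norm (snd (fst x)) = 1" "cos (pi / 2 * snd x) > 0"
      "sin (pi / 2 * snd x) > 0" "0 < snd x" "snd x < 1" if "x \<in> int_thickened_torus" for x
  proof -
    show b: "norm (fst (fst x)) = 1" "norm (snd (fst x)) = 1" "0 < snd x" "snd x < 1"
      using that by (auto simp: int_thickened_torus_def)
    show "cos (pi / 2 * snd x) > 0" by (rule cos_gt_zero) (use b in auto)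
    show "sin (pi / 2 * snd x) > 0" by (rule sin_gt_zero2) (use b in auto)
  qed
  have Y: "(norm (fst p))\<^sup>2 + (norm (snd p))\<^sup>2 = 1" "fst p \<noteq> 0" "snd p \<noteq> 0"
    if "p \<in> S3 - (hopf_m \<union> hopf_l)" for p
    using that by (auto simp: hopf_m_def hopf_l_def mem_S3)
  have "C1_diffeo int_thickened_torus (S3 - (hopf_m \<union> hopf_l)) f"
  proof (rule C1_diffeoI)
    show "C1_open UNIV f" unfolding f_def by (intro C1_open_intros)
    show "C1_open ?V g" unfolding g_def by (intro C1_open_intros) auto
    show "open ?V" by (intro open_Int open_Collect_neq continuous_intros)
    show "S3 - (hopf_m \<union> hopf_l) \<subseteq> ?V" using Y by blast
    show "f x \<in> S3 - (hopf_m \<union> hopf_l)" if "x \<in> int_thickened_torus" for x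
    proof -
      have "f x \<in> S3" using X[OF that] by (simp add: f_def mem_S3)
      moreover have "fst (f x) \<noteq> 0" "snd (f x) \<noteq> 0" using X[OF that] by (auto simp: f_def)
      ultimately show ?thesis by (simp add: hopf_m_def hopf_l_def)
    qed
    show "g p \<in> int_thickened_torus" if "p \<in> S3 - (hopf_m \<union> hopf_l)" for p
    proof -
      define A where "A = arctan (norm (snd p) * inverse (norm (fst p)))"
      have "A > 0" using Y[OF that] by (simp add: A_def)
      then have "2 / pi * A > 0" by simp
      moreover have "A < pi / 2" unfolding A_def by (rule arctan_ubound)
      then have "2 / pi * A < 1" by (simp add: field_simps)
      moreover have "snd (g p) = 2 / pi * A" by (simp only: g_def A_def snd_conv)
      moreover have "norm (fst (fst (g p))) = 1" "norm (snd (fst (g p))) = 1"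
        using Y[OF that] by (simp_all add: g_def)
      ultimately show ?thesis
        by (simp only: int_thickened_torus_def mem_Times_iff mem_sphere_0 greaterThanLessThan_iff)
    qed
    show "g (f x) = x" if "x \<in> int_thickened_torus" for x
    proof -
      have "arctan (sin (pi / 2 * snd x) * inverse (cos (pi / 2 * snd x))) = pi / 2 * snd x"
      proof -
        have "sin (pi / 2 * snd x) * inverse (cos (pi / 2 * snd x)) = tan (pi / 2 * snd x)"
          by (simp only: tan_def divide_inverse)
        moreover have "- (pi / 2) < pi / 2 * snd x"
          using X(5)[OF that] mult_pos_pos[of "pi / 2" "snd x"] pi_gt_zero by linarith
        moreover have "pi / 2 * snd x < pi / 2" using X(6)[OF that] by simp
        ultimately show ?thesis by (simp add: arctan_tan)
      qed
      moreover have n: "norm (fst (f x)) = cos (pi / 2 * snd x)" "norm (snd (f x)) = sin (pi / 2 * snd x)"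
        using X(1-4)[OF that] by (simp_all add: f_def)
      ultimately have "snd (g (f x)) = 2 / pi * (pi / 2 * snd x)" by (simp only: g_def snd_conv)
      then have "snd (g (f x)) = snd x" by simp
      moreover have "fst (g (f x)) = fst x"
        unfolding g_def fst_conv n using X(3,4)[OF that] by (simp add: f_def prod_eq_iff)
      ultimately show ?thesis by (simp add: prod_eq_iff)
    qed
    show "f (g p) = p" if "p \<in> S3 - (hopf_m \<union> hopf_l)" for p
    proof -
      define c s where "c = norm (fst p)" and "s = norm (snd p)"
      have cs: "c > 0" "s > 0" "c\<^sup>2 + s\<^sup>2 = 1" using Y[OF that] by (auto simp: c_def s_def)
      have "1 + (s * inverse c)\<^sup>2 = (inverse c)\<^sup>2"
        using cs by (simp add: field_simps)
      then have sq: "sqrt (1 + (s * inverse c)\<^sup>2) = inverse c" using cs by simp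
      have "cos (arctan (s * inverse c)) = c" "sin (arctan (s * inverse c)) = s"
        unfolding cos_arctan sin_arctan sq using cs by (auto simp: field_simps)
      then show ?thesis using cs
        by (simp add: f_def g_def prod_eq_iff flip: c_def s_def)
    qed
  qed auto
  then show ?thesis by blast
qed

theorem ex_solid_torus_identification:
  assumes "0 < r" "r < 1"
  shows "\<exists>h. C1_diffeo int_solid_torus (S3 - unknot_nbhd r) h"
proof -
  define \<rho> where "\<rho> = sqrt (1 - r\<^sup>2)"
  have r2: "0 < r\<^sup>2" "r\<^sup>2 < 1" using assms by (auto simp: power_less_one_iff)
  have \<rho>: "\<rho> > 0" "\<rho>\<^sup>2 = 1 - r\<^sup>2" using r2 by (auto simp: \<rho>_def)
  define P :: "(complex \<times> real) \<times> real \<Rightarrow> complex" where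
    "P = (\<lambda>x. Complex (tan (pi / 2 * snd (fst x))) (tan (pi * (snd x + - (1 / 2)))))"
  define Z where "Z = (\<lambda>x. (\<rho> * inverse (sqrt (1 + (norm (P x))\<^sup>2))) *\<^sub>R P x)"
  define f where "f = (\<lambda>x. (Z x, sqrt (1 + - ((norm (Z x))\<^sup>2)) *\<^sub>R fst (fst x)))"
  define Q where "Q = (\<lambda>p::complex \<times> complex. inverse (sqrt (\<rho>\<^sup>2 + - ((norm (fst p))\<^sup>2))) *\<^sub>R fst p)"
  define g where "g = (\<lambda>p. ((inverse (norm (snd p)) *\<^sub>R snd p, 2 / pi * arctan (Re (Q p))),
                       1 / 2 + 1 / pi * arctan (Im (Q p))))"
  let ?U = "{x :: (complex \<times> real) \<times> real. -1 < snd (fst x)} \<inter> {x. snd (fst x) < 1} \<inter>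
            {x. 0 < snd x} \<inter> {x. snd x < 1}"
  let ?V = "{p :: complex \<times> complex. (norm (fst p))\<^sup>2 < \<rho>\<^sup>2} \<inter> {p. snd p \<noteq> 0}"
  have ang: "- (pi / 2) < pi / 2 * snd (fst x)" "pi / 2 * snd (fst x) < pi / 2"
      "- (pi / 2) < pi * (snd x + - (1 / 2))" "pi * (snd x + - (1 / 2)) < pi / 2" if "x \<in> ?U" for x
    using that mult_strict_left_mono[of "-1" "snd (fst x)" "pi / 2"]
      mult_strict_left_mono[of "- (1 / 2)" "snd x + - (1 / 2)" pi]
      mult_strict_left_mono[of "snd x + - (1 / 2)" "1 / 2" pi] by auto
  have pos: "1 + (norm w)\<^sup>2 > 0" for w :: complex by (simp add: add_pos_nonneg)
  have nZ: "(norm (Z x))\<^sup>2 = \<rho>\<^sup>2 * (norm (P x))\<^sup>2 / (1 + (norm (P x))\<^sup>2)" for x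
    using \<rho> pos[of "P x"] by (simp add: Z_def power_mult_distrib power_inverse field_simps)
  have Zlt: "(norm (Z x))\<^sup>2 < \<rho>\<^sup>2" for x
    using \<rho> pos[of "P x"] unfolding nZ by (simp add: field_simps)
  have Z1: "0 < 1 + - ((norm (Z x))\<^sup>2)" for x using Zlt[of x] \<rho>(2) r2 by linarith
  have XU: "x \<in> ?U" "norm (fst (fst x)) = 1" if "x \<in> int_solid_torus" for x
    using that by (auto simp: int_solid_torus_def)
  have Y: "(norm (snd p))\<^sup>2 = 1 - (norm (fst p))\<^sup>2" "(norm (fst p))\<^sup>2 < \<rho>\<^sup>2" "snd p \<noteq> 0"
    if "p \<in> S3 - unknot_nbhd r" for p
  proof -
    have a: "(norm (fst p))\<^sup>2 + (norm (snd p))\<^sup>2 = 1" and b: "r < norm (snd p)"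
      using that by (auto simp: unknot_nbhd_def mem_S3)
    have "r\<^sup>2 < (norm (snd p))\<^sup>2" using b assms by (intro power_strict_mono) auto
    then show "(norm (fst p))\<^sup>2 < \<rho>\<^sup>2" using a \<rho> by simp
    show "(norm (snd p))\<^sup>2 = 1 - (norm (fst p))\<^sup>2" using a by simp
    show "snd p \<noteq> 0" using b assms by auto
  qed
  have "C1_diffeo int_solid_torus (S3 - unknot_nbhd r) f"
  proof (rule C1_diffeoI)
    have cos: "cos (pi / 2 * snd (fst x)) \<noteq> 0" "cos (pi * (snd x + - (1 / 2))) \<noteq> 0" if "x \<in> ?U" for x
      using ang[OF that] by (metis cos_gt_zero_pi less_irrefl)+
    have P: "C1_open ?U P" unfolding P_def
      by (intro C1_open_intros) (use cos in auto)
    have Z: "C1_open ?U Z" unfolding Z_def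
      by (intro C1_open_intros P) (use pos in \<open>auto simp: add_nonneg_eq_0_iff\<close>)
    show "C1_open ?U f" unfolding f_def
      by (intro C1_open_intros Z Z1)
    have "C1_open ?V Q" unfolding Q_def by (intro C1_open_intros) auto
    then show "C1_open ?V g" unfolding g_def by (intro C1_open_intros) auto
    show "open ?U" by (intro open_Int open_Collect_less continuous_intros)
    show "open ?V" by (intro open_Int open_Collect_less open_Collect_neq continuous_intros)
    show "int_solid_torus \<subseteq> ?U" using XU by blast
    show "S3 - unknot_nbhd r \<subseteq> ?V" using Y by blast
    show "f x \<in> S3 - unknot_nbhd r" if "x \<in> int_solid_torus" for x
    proof -
      have "r < sqrt (1 + - ((norm (Z x))\<^sup>2))"
        using Zlt[of x] \<rho> assms by (intro real_less_rsqrt) simp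
      then show ?thesis using XU[OF that] Z1[of x] assms
        by (simp add: f_def mem_S3 unknot_nbhd_def power_mult_distrib)
    qed
    show "g p \<in> int_solid_torus" if "p \<in> S3 - unknot_nbhd r" for p
    proof -
      have 1: "-1 < 2 / pi * arctan t" "2 / pi * arctan t < 1" for t
        using arctan_lbound[of t] arctan_ubound[of t] by (simp_all add: field_simps)
      have 2: "0 < 1 / 2 + 1 / pi * arctan t" "1 / 2 + 1 / pi * arctan t < 1" for t
        using 1[of t] by (simp_all add: field_simps)
      have "norm (fst (fst (g p))) = 1" using Y(3)[OF that] by (simp add: g_def)
      moreover have "snd (fst (g p)) = 2 / pi * arctan (Re (Q p))"
        "snd (g p) = 1 / 2 + 1 / pi * arctan (Im (Q p))" by (simp_all only: g_def fst_conv snd_conv)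
      ultimately show ?thesis using 1[of "Re (Q p)"] 2[of "Im (Q p)"]
        by (simp only: int_solid_torus_def mem_Times_iff mem_sphere_0 greaterThanLessThan_iff)
    qed
    show "g (f x) = x" if "x \<in> int_solid_torus" for x
    proof -
      have QP: "Q (f x) = P x"
      proof -
        have "\<rho>\<^sup>2 + - ((norm (Z x))\<^sup>2) = \<rho>\<^sup>2 / (1 + (norm (P x))\<^sup>2)"
          unfolding nZ using pos[of "P x"] by (simp add: field_simps)
        then have "sqrt (\<rho>\<^sup>2 + - ((norm (Z x))\<^sup>2)) = \<rho> / sqrt (1 + (norm (P x))\<^sup>2)"
          using \<rho>(1) by (simp add: real_sqrt_divide)
        then have "Q (f x) = inverse (\<rho> / sqrt (1 + (norm (P x))\<^sup>2)) *\<^sub>R Z x"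
          by (simp add: Q_def f_def)
        also have "\<dots> = P x" using \<rho>(1) pos[of "P x"] unfolding Z_def scaleR_scaleR
          by (simp add: field_simps)
        finally show ?thesis .
      qed
      have "arctan (Re (Q (f x))) = pi / 2 * snd (fst x)"
        "arctan (Im (Q (f x))) = pi * (snd x + - (1 / 2))"
        unfolding QP P_def complex.sel by (intro arctan_tan ang XU(1) that)+
      moreover have "inverse (norm (snd (f x))) *\<^sub>R snd (f x) = fst (fst x)"
        using Z1[of x] XU(2)[OF that] by (simp add: f_def)
      ultimately show ?thesis unfolding g_def by (simp add: prod_eq_iff field_simps)
    qed
    show "f (g p) = p" if "p \<in> S3 - unknot_nbhd r" for p
    proof -
      have PQ: "P (g p) = Q p"
        by (simp add: P_def g_def tan_arctan)
      define a where "a = \<rho>\<^sup>2 - (norm (fst p))\<^sup>2"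
      have a: "a > 0" using Y(2)[OF that] by (simp add: a_def)
      have Qa: "Q p = inverse (sqrt a) *\<^sub>R fst p" by (simp add: Q_def a_def)
      have "1 + (norm (Q p))\<^sup>2 = \<rho>\<^sup>2 / a"
        using a unfolding Qa by (simp add: power_mult_distrib power_inverse field_simps) (simp add: a_def)
      then have "sqrt (1 + (norm (Q p))\<^sup>2) = \<rho> / sqrt a" using \<rho>(1) by (simp add: real_sqrt_divide)
      then have Zg: "Z (g p) = fst p" using a \<rho>(1) by (simp add: Z_def PQ Qa field_simps)
      have "sqrt (1 + - ((norm (fst p))\<^sup>2)) = norm (snd p)"
        using Y(1)[OF that] by (metis norm_ge_zero real_sqrt_unique uminus_add_conv_diff add.commute)
      then show ?thesis using Y(3)[OF that] by (simp add: f_def Zg prod_eq_iff) (simp add: g_def)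
    qed
  qed
  then show ?thesis by blast
qed

end

theory Submission
  imports Defs
begin

text \<open>
  Composing with an embedding, even a time-dependent one, carries pseudo links to pseudo links and
  isotopies to isotopies.  Adjoining the fixed components and deleting them again identify pseudo
  links in the complement of the fixed link, up to isotopy, with mixed pseudo links.  A precrossing
  disc of a mixed pseudo link cannot meet the fixed circles: it would lie over fixed strands only,
  and a circle has no room for two transverse strands.  The complement of the Hopf link is the
  thickened torus; the complement of the unknot is larger than the solid torus, but it can be
  pushed into it by an isotopy of embeddings that maps the solid torus into itself at all times.
\<close>

section \<open>Embeddings and families of embeddings\<close>

text \<open>Isotopies are paths of parametrised links, so they are transported by postcomposition at
  each time. What shapes the notion of embedding is that the ambient spaces are not open in the
  surrounding vector space: a derivative relative to \<open>M\<close> is determined only along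
  \<open>M\<close> and may kill normal directions, so nonvanishing velocities and injective disc
  derivatives must be recovered from a left inverse.

  A mixed pseudo link by definition only lacks discs that meet both the fixed and the moving part.
  Discs with both strands on the fixed part are left to geometry. Once every disc is off the fixed
  link, so is every moving curve, because curves meet only at disc centres.

  The push must preserve the solid torus for the sake of injectivity on classes. An isotopy between
  two links of the solid torus may run through the larger complement. Pushing all of it inside also
  displaces its two ends, and these have to be led back without leaving the solid torus.\<close>

text \<open>
  Only derivatives relative to \<open>M\<close> occur, so \<open>f'\<close> matters on tangent vectors of \<open>M\<close> alone; the
  left inverse \<open>g\<close> makes it injective there.
\<close>

definition C1_embedding ::
  "'a::real_normed_vector set \<Rightarrow> 'b::real_normed_vector set \<Rightarrow> ('a \<Rightarrow> 'b) \<Rightarrow> bool" where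
  "C1_embedding M N f \<longleftrightarrow> f ` M \<subseteq> N \<and>
     (\<exists>f' :: 'a \<Rightarrow> 'a \<Rightarrow>\<^sub>L 'b. continuous_on M f' \<and>
        (\<forall>x\<in>M. (f has_derivative blinfun_apply (f' x)) (at x within M))) \<and>
     (\<exists>g. \<forall>x\<in>M. g (f x) = x \<and> g differentiable (at (f x) within f ` M))"

text \<open>The regularity mirrors that of \<open>pl_isotopy\<close>: C1 in space, with values and
  space derivatives jointly continuous in time and position.\<close>

definition C1_embedding_family ::
  "'a::real_normed_vector set \<Rightarrow> 'b::real_normed_vector set \<Rightarrow> (real \<Rightarrow> 'a \<Rightarrow> 'b) \<Rightarrow> bool" where
  "C1_embedding_family M N \<Phi> \<longleftrightarrow>
     (\<forall>t\<in>{0..1}. C1_embedding M N (\<Phi> t)) \<and>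
     continuous_on ({0..1} \<times> M) (\<lambda>(t, x). \<Phi> t x) \<and>
     (\<exists>\<Phi>' :: real \<Rightarrow> 'a \<Rightarrow> 'a \<Rightarrow>\<^sub>L 'b. continuous_on ({0..1} \<times> M) (\<lambda>(t, x). \<Phi>' t x) \<and>
        (\<forall>t\<in>{0..1}. \<forall>x\<in>M. (\<Phi> t has_derivative blinfun_apply (\<Phi>' t x)) (at x within M)))"

lemma C1_embedding_inj_on: "C1_embedding M N f \<Longrightarrow> inj_on f M"
  unfolding C1_embedding_def by (metis inj_onI)

lemma C1_embedding_mono:
  assumes "C1_embedding M N f" "M' \<subseteq> M" "f ` M' \<subseteq> N'"
  shows "C1_embedding M' N' f"
proof -
  obtain f' :: "'a \<Rightarrow> 'a \<Rightarrow>\<^sub>L 'b" where f': "continuous_on M f'"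
    "\<And>x. x \<in> M \<Longrightarrow> (f has_derivative blinfun_apply (f' x)) (at x within M)"
    using assms(1) unfolding C1_embedding_def by blast
  obtain g where g: "\<And>x. x \<in> M \<Longrightarrow> g (f x) = x"
    "\<And>x. x \<in> M \<Longrightarrow> g differentiable (at (f x) within f ` M)"
    using assms(1) unfolding C1_embedding_def by blast
  show ?thesis
    unfolding C1_embedding_def
  proof (intro conjI exI[of _ f'] exI[of _ g] ballI)
    show "f ` M' \<subseteq> N'" by (rule assms)
    show "continuous_on M' f'" by (rule continuous_on_subset[OF f'(1) assms(2)])
    fix x assume x: "x \<in> M'"
    show "(f has_derivative blinfun_apply (f' x)) (at x within M')"
      using f'(2) x assms(2) by (blast intro: has_derivative_subset)
    show "g (f x) = x" using g x assms(2) by blast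
    show "g differentiable (at (f x) within f ` M')"
      using g(2)[of x] x assms(2) by (blast intro: differentiable_within_subset)
  qed
qed

lemma C1_embedding_family_mono:
  assumes "C1_embedding_family M N \<Phi>" "M' \<subseteq> M" "\<And>t. t \<in> {0..1} \<Longrightarrow> \<Phi> t ` M' \<subseteq> N'"
  shows "C1_embedding_family M' N' \<Phi>"
proof -
  obtain \<Phi>' :: "real \<Rightarrow> 'a \<Rightarrow> 'a \<Rightarrow>\<^sub>L 'b" where \<Phi>': "continuous_on ({0..1} \<times> M) (\<lambda>(t, x). \<Phi>' t x)"
    "\<And>t x. t \<in> {0..1} \<Longrightarrow> x \<in> M \<Longrightarrow> (\<Phi> t has_derivative blinfun_apply (\<Phi>' t x)) (at x within M)"
    using assms(1) unfolding C1_embedding_family_def by blast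
  have sub: "{0..1::real} \<times> M' \<subseteq> {0..1} \<times> M" using assms(2) by auto
  show ?thesis
    unfolding C1_embedding_family_def
  proof (intro conjI exI[of _ \<Phi>'] ballI)
    show "C1_embedding M' N' (\<Phi> t)" if "t \<in> {0..1}" for t
      using assms that unfolding C1_embedding_family_def by (blast intro: C1_embedding_mono)
    show "continuous_on ({0..1} \<times> M') (\<lambda>(t, x). \<Phi> t x)"
      using assms(1) sub unfolding C1_embedding_family_def by (blast intro: continuous_on_subset)
    show "continuous_on ({0..1} \<times> M') (\<lambda>(t, x). \<Phi>' t x)"
      by (rule continuous_on_subset[OF \<Phi>'(1) sub])
    show "(\<Phi> t has_derivative blinfun_apply (\<Phi>' t x)) (at x within M')"
      if "t \<in> {0..1}" "x \<in> M'" for t x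
      using \<Phi>'(2) that assms(2) by (blast intro: has_derivative_subset)
  qed
qed

lemma C1_embedding_family_const:
  assumes "C1_embedding M N f"
  shows "C1_embedding_family M N (\<lambda>_. f)"
proof -
  obtain f' :: "'a \<Rightarrow> 'a \<Rightarrow>\<^sub>L 'b" where f': "continuous_on M f'"
    "\<And>x. x \<in> M \<Longrightarrow> (f has_derivative blinfun_apply (f' x)) (at x within M)"
    using assms unfolding C1_embedding_def by blast
  have f: "continuous_on M f" by (rule has_derivative_continuous_on[OF f'(2)])
  have c: "continuous_on ({0..1} \<times> M) (\<lambda>(t::real, x). h x)"
    if "continuous_on M h" for h :: "'a \<Rightarrow> 'c::topological_space"
    unfolding split_beta by (rule continuous_on_compose2[OF that]) (auto intro!: continuous_intros)
  show ?thesis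
    unfolding C1_embedding_family_def
    by (intro conjI exI[of _ "\<lambda>_. f'"] ballI assms c f f'(1)) (rule f'(2))
qed

lemma C1_embedding_id: "M \<subseteq> N \<Longrightarrow> C1_embedding M N (\<lambda>x. x)"
  unfolding C1_embedding_def
  by (intro conjI exI[of _ "\<lambda>_. id_blinfun"] exI[of _ "\<lambda>x. x"])
    (auto intro!: continuous_intros derivative_eq_intros)

section \<open>Diffeomorphisms as embeddings\<close>

text \<open>The open extension \<open>F\<close> agrees with \<open>f\<close> on \<open>X\<close>
  alone, so what passes from \<open>F\<close> to \<open>f\<close> is the derivative within
  \<open>X\<close>.\<close>

lemma C1_map_has_derivative_within:
  assumes "C1_map X f"
  obtains f' :: "'a::real_normed_vector \<Rightarrow> 'a \<Rightarrow>\<^sub>L 'b::real_normed_vector" where "continuous_on X f'"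
    "\<And>x. x \<in> X \<Longrightarrow> (f has_derivative blinfun_apply (f' x)) (at x within X)"
proof -
  obtain U F and F' :: "'a \<Rightarrow> 'a \<Rightarrow>\<^sub>L 'b" where F: "X \<subseteq> U" "\<And>x. x \<in> X \<Longrightarrow> F x = f x"
    "\<And>x. x \<in> U \<Longrightarrow> (F has_derivative blinfun_apply (F' x)) (at x)" "continuous_on U F'"
    using assms unfolding C1_map_def by blast
  show ?thesis
  proof (rule that)
    show "continuous_on X F'" by (rule continuous_on_subset[OF F(4,1)])
    show "(f has_derivative blinfun_apply (F' x)) (at x within X)" if "x \<in> X" for x
      by (rule has_derivative_transform[OF that _ has_derivative_at_withinI[OF F(3)]])
        (use F that in auto)
  qed
qed

lemma C1_diffeo_embedding:
  assumes "C1_diffeo X Y f"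
  shows "C1_embedding X Y f" "C1_embedding Y X (inv_into X f)"
proof -
  have bij: "bij_betw f X Y" and C1: "C1_map X f" "C1_map Y (inv_into X f)"
    using assms by (auto simp: C1_diffeo_def)
  have im: "f ` X = Y" "inv_into X f ` Y = X"
    using bij bij_betw_inv_into[OF bij] by (auto simp: bij_betw_def)
  have inv: "inv_into X f (f x) = x" if "x \<in> X" for x
    using bij that by (rule bij_betw_inv_into_left)
  have inv': "f (inv_into X f y) = y" if "y \<in> Y" for y
    using bij that by (rule bij_betw_inv_into_right)
  obtain f' :: "'a \<Rightarrow> 'a \<Rightarrow>\<^sub>L 'b" where f': "continuous_on X f'"
    "\<And>x. x \<in> X \<Longrightarrow> (f has_derivative blinfun_apply (f' x)) (at x within X)"
    using C1_map_has_derivative_within[OF C1(1)] by blast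
  obtain g' :: "'b \<Rightarrow> 'b \<Rightarrow>\<^sub>L 'a" where g': "continuous_on Y g'"
    "\<And>y. y \<in> Y \<Longrightarrow> (inv_into X f has_derivative blinfun_apply (g' y)) (at y within Y)"
    using C1_map_has_derivative_within[OF C1(2)] by blast
  show "C1_embedding X Y f"
    unfolding C1_embedding_def im
    by (intro conjI exI[of _ f'] exI[of _ "inv_into X f"] ballI f' inv subset_refl)
      (use g'(2) im in \<open>auto simp: differentiable_def\<close>)
  have "f differentiable (at (inv_into X f y) within X)" if "y \<in> Y" for y
    using f'(2)[of "inv_into X f y"] im(2) that by (auto simp: differentiable_def)
  then show "C1_embedding Y X (inv_into X f)"
    unfolding C1_embedding_def im
    by (intro conjI exI[of _ g'] exI[of _ f] ballI g' inv' subset_refl)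
qed


section \<open>Transport of pseudo links along embeddings\<close>

definition pl_image :: "('a \<Rightarrow> 'b) \<Rightarrow> 'a pseudo_link \<Rightarrow> 'b pseudo_link" where
  "pl_image f P = (image f ` fst P, image f ` snd P)"

lemma pseudo_link_paramD:
  assumes "pseudo_link_param M n k \<Gamma> \<Delta>"
  shows "0 < n" and "j < n \<Longrightarrow> regular_closed_curve (\<Gamma> j)" and "j < n \<Longrightarrow> range (\<Gamma> j) \<subseteq> M"
    and "i < k \<Longrightarrow> embedded_disc (\<Delta> i)" and "i < k \<Longrightarrow> \<Delta> i ` cball 0 1 \<subseteq> M"
    and "i < k \<Longrightarrow> \<Delta> i ` cball 0 1 \<inter> (\<Union>j<n. range (\<Gamma> j)) = \<Delta> i ` cross"
  using assms by (simp_all only: pseudo_link_param_def)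

lemma pl_trace_image: "pl_trace n k (\<lambda>j s. f (\<Gamma> j s)) (\<lambda>i z. f (\<Delta> i z)) = pl_image f (pl_trace n k \<Gamma> \<Delta>)"
  by (simp add: pl_trace_def pl_image_def image_image)

lemma pl_image_compose: "pl_image f (pl_image g P) = pl_image (\<lambda>x. f (g x)) P"
  by (simp add: pl_image_def image_image)

text \<open>Stated relative to \<open>M\<close> because \<open>\<Phi> 0\<close> and the composites
  of a diffeomorphism with its inverse are known to be the identity only on the ambient
  space.\<close>

lemma pl_image_ident:
  assumes "P \<in> pseudo_links M" "\<And>x. x \<in> M \<Longrightarrow> f x = x"
  shows "pl_image f P = P"
proof -
  obtain n k \<Gamma> \<Delta> where p: "pseudo_link_param M n k \<Gamma> \<Delta>" "P = pl_trace n k \<Gamma> \<Delta>"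
    using assms(1) by (auto simp: pseudo_links_def)
  have "C \<subseteq> M" if "C \<in> fst P \<union> snd P" for C
    using that pseudo_link_paramD(3,5)[OF p(1)] unfolding p(2) pl_trace_def fst_conv snd_conv by blast
  then have "f ` C = C" if "C \<in> fst P \<union> snd P" for C
    using that assms(2) by (force simp: image_def)
  then show ?thesis by (cases P) (force simp: pl_image_def image_def)
qed

text \<open>A derivative relative to \<open>M\<close> suffices for a genuine derivative of the
  composite, since the whole curve runs inside \<open>M\<close>.\<close>

lemma has_vector_derivative_image:
  assumes "(c has_vector_derivative v) (at s)" "(f has_derivative f') (at (c s) within M)" "range c \<subseteq> M"
  shows "((\<lambda>s. f (c s)) has_vector_derivative f' v) (at s)"
  using vector_derivative_diff_chain_within[OF assms(1) has_derivative_subset[OF assms(2,3)]]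
  by (simp add: o_def)

lemma regular_closed_curve_image:
  assumes f: "C1_embedding M N f" and c: "regular_closed_curve c" "range c \<subseteq> M"
  shows "regular_closed_curve (\<lambda>s. f (c s))"
proof -
  obtain f' :: "'a \<Rightarrow> 'a \<Rightarrow>\<^sub>L 'b" where f': "continuous_on M f'"
    "\<And>x. x \<in> M \<Longrightarrow> (f has_derivative blinfun_apply (f' x)) (at x within M)"
    using f unfolding C1_embedding_def by blast
  obtain g where g: "\<And>x. x \<in> M \<Longrightarrow> g (f x) = x"
    "\<And>x. x \<in> M \<Longrightarrow> g differentiable (at (f x) within f ` M)"
    using f unfolding C1_embedding_def by blast
  obtain D where D: "\<And>s. (c has_vector_derivative D s) (at s)" "continuous_on UNIV D"
    using c(1) unfolding regular_closed_curve_def C1_differentiable_on_def by blast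
  have cM: "c s \<in> M" for s using c(2) by auto
  have fc: "((\<lambda>s. f (c s)) has_vector_derivative f' (c s) (D s)) (at s)" for s
    by (rule has_vector_derivative_image[OF D(1) f'(2)[OF cM] c(2)])
  \<comment> \<open>\<open>f'\<close> may vanish on vectors that are not tangent to
    \<open>M\<close>. Since \<open>g\<close> undoes \<open>f\<close> along the curve, the chain rule
    gives \<open>D s = g' (f' (c s) (D s))\<close>, and \<open>D s\<close> is nonzero.\<close>
  have nz: "f' (c s) (D s) \<noteq> 0" for s
  proof
    assume 0: "f' (c s) (D s) = 0"
    obtain g' where g': "(g has_derivative g') (at (f (c s)) within f ` M)"
      using g(2)[OF cM] by (auto simp: differentiable_def)
    have "((\<lambda>s. g (f (c s))) has_vector_derivative g' (f' (c s) (D s))) (at s)"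
      by (rule has_vector_derivative_image[OF fc g']) (use cM in auto)
    moreover have "(\<lambda>s. g (f (c s))) = c" using g(1) cM by auto
    ultimately have "D s = g' (f' (c s) (D s))" using D(1) by (metis vector_derivative_at)
    also have "\<dots> = 0" using 0 has_derivative_linear[OF g'] by (simp add: linear_0)
    finally show False using c(1) vector_derivative_at[OF D(1)] by (simp add: regular_closed_curve_def)
  qed
  have "continuous_on UNIV c" by (metis D(1) continuous_at_imp_continuous_on has_vector_derivative_continuous)
  then have "continuous_on UNIV (\<lambda>s. f' (c s) (D s))"
    by (intro continuous_intros D(2) continuous_on_compose2[OF f'(1)]) (use cM in auto)
  then have "(\<lambda>s. f (c s)) C1_differentiable_on UNIV"
    unfolding C1_differentiable_on_def by (intro exI[of _ "\<lambda>s. f' (c s) (D s)"] conjI ballI fc)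
  then show ?thesis
    using c(1) nz vector_derivative_at[OF fc] by (simp add: regular_closed_curve_def)
qed

text \<open>\<open>frechet_derivative_unique_within\<close> does not apply at boundary points of the disc.\<close>

lemma has_derivative_unique_within_cball:
  assumes "(d has_derivative D) (at z within cball 0 1)" "(d has_derivative E) (at z within cball 0 1)"
    and z: "z \<in> cball 0 (1::real)"
  shows "D = (E :: 'a::real_normed_vector \<Rightarrow> 'b::real_normed_vector)"
proof -
  have lin: "linear D" "linear E" using assms by (auto intro: has_derivative_linear)
  \<comment> \<open>By convexity the segment from \<open>z\<close> to \<open>y\<close> stays in the
    disc, even for \<open>z\<close> on the boundary. The one-sided derivative of \<open>d\<close> at
    the start of this segment determines both values.\<close>
  have chord: "D (y - z) = E (y - z)" if y: "y \<in> cball 0 1" for y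
  proof -
    define \<gamma> where "\<gamma> = (\<lambda>u::real. z + u *\<^sub>R (y - z))"
    have \<gamma>: "(\<gamma> has_vector_derivative (y - z)) (at 0 within {0..1})"
      unfolding \<gamma>_def by (auto intro!: derivative_eq_intros)
    have "\<gamma> u \<in> cball 0 1" if "u \<in> {0..1}" for u
    proof -
      have "\<gamma> u = (1 - u) *\<^sub>R z + u *\<^sub>R y" by (simp add: \<gamma>_def algebra_simps)
      then show ?thesis using convexD_alt[OF convex_cball z y] that by auto
    qed
    then have "\<gamma> ` {0..1} \<subseteq> cball 0 1" by blast
    moreover have "\<gamma> 0 = z" by (simp add: \<gamma>_def)
    ultimately have "(d has_derivative D) (at (\<gamma> 0) within \<gamma> ` {0..1})"
      "(d has_derivative E) (at (\<gamma> 0) within \<gamma> ` {0..1})"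
      using assms by (auto intro: has_derivative_subset)
    from this[THEN vector_derivative_diff_chain_within[OF \<gamma>]]
    show ?thesis
      by (intro vector_derivative_unique_within_closed_interval[where a = 0 and b = 1 and x = 0 and f = "d \<circ> \<gamma>"]) auto
  qed
  \<comment> \<open>\<open>y\<close> is the difference of the two chord directions
    \<open>y - z\<close> and \<open>0 - z\<close>. By homogeneity agreement on the disc then extends
    to all vectors.\<close>
  have eq: "D y = E y" if "y \<in> cball 0 1" for y
    using chord[OF that] chord[of 0] lin by (simp add: linear_diff linear_neg)
  show ?thesis
  proof
    fix v
    show "D v = E v"
    proof (cases "v = 0")
      case False
      then have "v = norm v *\<^sub>R (v /\<^sub>R norm v)" by simp
      moreover have "v /\<^sub>R norm v \<in> cball 0 1" using False by simp
      ultimately show ?thesis using eq lin by (metis linear_scale)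
    qed (simp add: lin linear_0)
  qed
qed

lemma embedded_disc_image:
  assumes f: "C1_embedding M N f" and d: "embedded_disc d" "d ` cball 0 1 \<subseteq> M"
  shows "embedded_disc (\<lambda>z. f (d z))"
proof -
  obtain f' :: "'a \<Rightarrow> 'a \<Rightarrow>\<^sub>L 'b" where f': "continuous_on M f'"
    "\<And>x. x \<in> M \<Longrightarrow> (f has_derivative blinfun_apply (f' x)) (at x within M)"
    using f unfolding C1_embedding_def by blast
  obtain g where g: "\<And>x. x \<in> M \<Longrightarrow> g (f x) = x"
    "\<And>x. x \<in> M \<Longrightarrow> g differentiable (at (f x) within f ` M)"
    using f unfolding C1_embedding_def by blast
  obtain d' :: "complex \<Rightarrow> complex \<Rightarrow>\<^sub>L 'a" where d': "continuous_on (cball 0 1) d'"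
    "\<And>z. z \<in> cball 0 1 \<Longrightarrow> (d has_derivative blinfun_apply (d' z)) (at z within cball 0 1)"
    "\<And>z. z \<in> cball 0 1 \<Longrightarrow> inj (blinfun_apply (d' z))"
    and inj: "inj_on d (cball 0 1)"
    using d(1) unfolding embedded_disc_def by blast
  have dM: "d z \<in> M" if "z \<in> cball 0 1" for z using d(2) that by blast
  have fd: "((\<lambda>z. f (d z)) has_derivative blinfun_apply (f' (d z) o\<^sub>L d' z)) (at z within cball 0 1)"
    if z: "z \<in> cball 0 1" for z
    using has_derivative_in_compose[OF d'(2)[OF z] has_derivative_subset[OF f'(2)[OF dM[OF z]] d(2)]]
    by (simp add: blinfun_compose.rep_eq o_def)
  \<comment> \<open>Again the left inverse: \<open>g\<close> composed with \<open>f\<close> and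
    \<open>d\<close> is \<open>d\<close> on the disc, so by uniqueness of the derivative
    \<open>g'\<close> recovers \<open>d' z\<close> from the composite, and \<open>d' z\<close> is
    injective.\<close>
  have inj': "inj (blinfun_apply (f' (d z) o\<^sub>L d' z))" if z: "z \<in> cball 0 1" for z
  proof -
    obtain g' where g': "(g has_derivative g') (at (f (d z)) within f ` M)"
      using g(2)[OF dM[OF z]] by (auto simp: differentiable_def)
    have "((\<lambda>z. g (f (d z))) has_derivative (\<lambda>v. g' ((f' (d z) o\<^sub>L d' z) v))) (at z within cball 0 1)"
      by (rule has_derivative_in_compose[OF fd[OF z] has_derivative_subset[OF g']]) (use dM in auto)
    then have "(d has_derivative (\<lambda>v. g' ((f' (d z) o\<^sub>L d' z) v))) (at z within cball 0 1)"
      by (rule has_derivative_transform[rotated 2]) (use z g(1) dM in auto)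
    from has_derivative_unique_within_cball[OF this d'(2)[OF z] z]
    have uniq: "g' ((f' (d z) o\<^sub>L d' z) v) = d' z v" for v by (rule fun_cong)
    show ?thesis
    proof (rule injI)
      fix u v assume "(f' (d z) o\<^sub>L d' z) u = (f' (d z) o\<^sub>L d' z) v"
      then have "d' z u = d' z v" by (metis uniq)
      then show "u = v" by (rule injD[OF d'(3)[OF z]])
    qed
  qed
  have "continuous_on (cball 0 1) d" by (rule has_derivative_continuous_on[OF d'(2)])
  then have "continuous_on (cball 0 1) (\<lambda>z. f' (d z) o\<^sub>L d' z)"
    by (intro bounded_bilinear.continuous_on[OF bounded_bilinear_blinfun_compose] d'(1)
        continuous_on_compose2[OF f'(1)]) (use dM in auto)
  moreover have "inj_on (\<lambda>z. f (d z)) (cball 0 1)"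
  proof (rule inj_onI)
    fix z w assume "z \<in> cball 0 1" "w \<in> cball 0 1" "f (d z) = f (d w)"
    then show "z = w" using g(1)[OF dM] inj_onD[OF inj] by metis
  qed
  ultimately show ?thesis
    unfolding embedded_disc_def
    by (intro conjI exI[of _ "\<lambda>z. f' (d z) o\<^sub>L d' z"] ballI fd inj')
qed

text \<open>Apart from regularity, every condition on a parametrised pseudo link speaks of which
  points coincide, and an injective map neither creates nor destroys coincidences.\<close>

lemma pseudo_link_param_image:
  assumes f: "C1_embedding M N f" and p: "pseudo_link_param M n k \<Gamma> \<Delta>"
  shows "pseudo_link_param N n k (\<lambda>j s. f (\<Gamma> j s)) (\<lambda>i z. f (\<Delta> i z))"
proof -
  have fM: "f x \<in> N" if "x \<in> M" for x using f that by (auto simp: C1_embedding_def)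
  have inj: "f x = f y \<longleftrightarrow> x = y" if "x \<in> M" "y \<in> M" for x y
    using inj_on_eq_iff[OF C1_embedding_inj_on[OF f]] that by blast
  note \<Gamma> = pseudo_link_paramD(2,3)[OF p]
  note \<Delta> = pseudo_link_paramD(4,5)[OF p]
  have \<Gamma>M: "\<Gamma> j s \<in> M" if "j < n" for j s using \<Gamma>(2) that by blast
  have \<Delta>M: "\<Delta> i z \<in> M" if "i < k" "z \<in> cball 0 1" for i z using \<Delta>(2) that by blast
  have \<Delta>0: "\<Delta> i 0 \<in> M" if "i < k" for i using \<Delta>M that by simp
  have Un: "(\<Union>j<n. range (\<Gamma> j)) \<subseteq> M" using \<Gamma>M by blast
  show ?thesis
    unfolding pseudo_link_param_def
  proof (intro conjI allI impI)
    show "0 < n" using p by (simp add: pseudo_link_param_def)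
    show "regular_closed_curve (\<lambda>s. f (\<Gamma> j s))" if "j < n" for j
      by (rule regular_closed_curve_image[OF f \<Gamma>[OF that]])
    show "range (\<lambda>s. f (\<Gamma> j s)) \<subseteq> N" if "j < n" for j using fM \<Gamma>M[OF that] by auto
    show "embedded_disc (\<lambda>z. f (\<Delta> i z))" if "i < k" for i
      by (rule embedded_disc_image[OF f \<Delta>[OF that]])
    show "(\<lambda>z. f (\<Delta> i z)) ` cball 0 1 \<subseteq> N" if "i < k" for i using fM \<Delta>M[OF that] by auto
    have *: "(\<lambda>z. f (\<Delta> i z)) ` A = f ` \<Delta> i ` A" for i A by (simp add: image_image)
    have "disjoint_family_on (\<lambda>i. \<Delta> i ` cball 0 1) {..<k}"
      using p by (simp add: pseudo_link_param_def)
    then show "disjoint_family_on (\<lambda>i. (\<lambda>z. f (\<Delta> i z)) ` cball 0 1) {..<k}"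
      unfolding disjoint_family_on_def *
      by (auto simp flip: inj_on_image_Int[OF C1_embedding_inj_on[OF f] \<Delta>(2) \<Delta>(2)])
    show "(\<lambda>z. f (\<Delta> i z)) ` cball 0 1 \<inter> (\<Union>j<n. range (\<lambda>s. f (\<Gamma> j s))) = (\<lambda>z. f (\<Delta> i z)) ` cross"
      if i: "i < k" for i
    proof -
      have "\<Delta> i ` cball 0 1 \<inter> (\<Union>j<n. range (\<Gamma> j)) = \<Delta> i ` cross"
        using p i by (simp add: pseudo_link_param_def)
      moreover have "(\<Union>j<n. range (\<lambda>s. f (\<Gamma> j s))) = f ` (\<Union>j<n. range (\<Gamma> j))" by auto
      ultimately show ?thesis
        unfolding * using inj_on_image_Int[OF C1_embedding_inj_on[OF f] \<Delta>(2)[OF i] Un] by simp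
    qed
    show "card {(j, s). j < n \<and> s \<in> {0..<1} \<and> f (\<Gamma> j s) = f (\<Delta> i 0)} = 2" if i: "i < k" for i
    proof -
      have "{(j, s). j < n \<and> s \<in> {0..<1} \<and> f (\<Gamma> j s) = f (\<Delta> i 0)} =
            {(j, s). j < n \<and> s \<in> {0..<1} \<and> \<Gamma> j s = \<Delta> i 0}"
        using inj[OF \<Gamma>M \<Delta>0[OF i]] by auto
      then show ?thesis using p i by (simp add: pseudo_link_param_def)
    qed
    have "f (\<Gamma> j s) \<in> (\<lambda>i. f (\<Delta> i 0)) ` {..<k} \<longleftrightarrow> \<Gamma> j s \<in> (\<lambda>i. \<Delta> i 0) ` {..<k}" if "j < n" for j s
      using inj[OF \<Gamma>M[OF that] \<Delta>0] by (auto simp: image_iff)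
    then have "{(j, s). j < n \<and> s \<in> {0..<1} \<and> f (\<Gamma> j s) \<notin> (\<lambda>i. f (\<Delta> i 0)) ` {..<k}} =
               {(j, s). j < n \<and> s \<in> {0..<1} \<and> \<Gamma> j s \<notin> (\<lambda>i. \<Delta> i 0) ` {..<k}}" (is "?A = ?B")
      by blast
    moreover have "inj_on (\<lambda>(j, s). \<Gamma> j s) ?B" using p by (simp add: pseudo_link_param_def)
    then have "inj_on (f \<circ> (\<lambda>(j, s). \<Gamma> j s)) ?B"
      by (rule comp_inj_on[OF _ inj_on_subset[OF C1_embedding_inj_on[OF f]]]) (use \<Gamma>M in auto)
    then have "inj_on (\<lambda>(j, s). f (\<Gamma> j s)) ?B" by (simp only: o_def case_prod_unfold)
    ultimately show "inj_on (\<lambda>(j, s). f (\<Gamma> j s)) ?A" by simp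
  qed
qed

lemma pl_image_pseudo_links:
  assumes "C1_embedding M N f" "P \<in> pseudo_links M"
  shows "pl_image f P \<in> pseudo_links N"
proof -
  obtain n k \<Gamma> \<Delta> where p: "pseudo_link_param M n k \<Gamma> \<Delta>" and P: "P = pl_trace n k \<Gamma> \<Delta>"
    using assms(2) by (auto simp: pseudo_links_def)
  show ?thesis
    unfolding pseudo_links_def P pl_trace_image[symmetric]
    using pseudo_link_param_image[OF assms(1) p] by blast
qed

section \<open>Images of isotopies\<close>

lemma pl_isotopy_image:
  assumes \<Phi>: "C1_embedding_family M N \<Phi>" and iso: "pl_isotopy M n k \<Gamma> \<Delta>"
  shows "pl_isotopy N n k (\<lambda>t j s. \<Phi> t (\<Gamma> t j s)) (\<lambda>t i z. \<Phi> t (\<Delta> t i z))"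
proof -
  obtain \<Phi>' :: "real \<Rightarrow> 'a \<Rightarrow> 'a \<Rightarrow>\<^sub>L 'b" where \<Phi>': "continuous_on ({0..1} \<times> M) (\<lambda>(t, x). \<Phi>' t x)"
    "\<And>t x. t \<in> {0..1} \<Longrightarrow> x \<in> M \<Longrightarrow> (\<Phi> t has_derivative blinfun_apply (\<Phi>' t x)) (at x within M)"
    using \<Phi> unfolding C1_embedding_family_def by blast
  have cont: "continuous_on ({0..1} \<times> M) (\<lambda>(t, x). \<Phi> t x)"
    and emb: "\<And>t. t \<in> {0..1} \<Longrightarrow> C1_embedding M N (\<Phi> t)"
    using \<Phi> unfolding C1_embedding_family_def by auto
  have p: "pseudo_link_param M n k (\<Gamma> t) (\<Delta> t)" if "t \<in> {0..1}" for t
    using iso that by (simp add: pl_isotopy_def)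
  note \<Gamma> = pseudo_link_paramD(2,3)[OF p]
  note \<Delta> = pseudo_link_paramD(4,5)[OF p]
  \<comment> \<open>Time is carried along as first coordinate, so a moving map applied to a moving
    point is an ordinary composition. This is used for values and derivatives alike.\<close>
  have comp: "continuous_on ({0..1} \<times> S) (\<lambda>(t, s). H t (G t s))"
    if "continuous_on ({0..1} \<times> S) (\<lambda>(t, s). G t s)" "continuous_on ({0..1} \<times> M) (\<lambda>(t, x). H t x)"
      and "\<And>t s. t \<in> {0..1} \<Longrightarrow> s \<in> S \<Longrightarrow> G t s \<in> M"
    for S :: "'d::topological_space set" and G :: "real \<Rightarrow> 'd \<Rightarrow> 'a" and H :: "real \<Rightarrow> 'a \<Rightarrow> 'e::topological_space"
  proof -
    have "continuous_on ({0..1} \<times> S) (\<lambda>p. (fst p, (\<lambda>(t, s). G t s) p))"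
      by (intro continuous_on_Pair continuous_on_fst continuous_on_id that(1))
    from continuous_on_compose2[OF that(2) this] show ?thesis
      using that(3) by (fastforce simp: split_beta)
  qed
  show ?thesis
    unfolding pl_isotopy_def
  proof (intro conjI ballI allI impI)
    show "pseudo_link_param N n k (\<lambda>j s. \<Phi> t (\<Gamma> t j s)) (\<lambda>i z. \<Phi> t (\<Delta> t i z))" if "t \<in> {0..1}" for t
      by (rule pseudo_link_param_image[OF emb p]) (use that in auto)
  next
    fix j assume j: "j < n"
    have c: "continuous_on ({0..1} \<times> UNIV) (\<lambda>(t, s). \<Gamma> t j s)"
      and dc: "continuous_on ({0..1} \<times> UNIV) (\<lambda>(t, s). vector_derivative (\<Gamma> t j) (at s))"
      using iso j by (auto simp: pl_isotopy_def)
    have M: "\<Gamma> t j s \<in> M" if "t \<in> {0..1}" for t s using \<Gamma>(2)[OF that j] by auto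
    show "continuous_on ({0..1} \<times> UNIV) (\<lambda>(t, s). \<Phi> t (\<Gamma> t j s))"
      by (rule comp[OF c cont M])
    have "continuous_on ({0..1} \<times> UNIV) (\<lambda>p. \<Phi>' (fst p) (\<Gamma> (fst p) j (snd p)) (vector_derivative (\<Gamma> (fst p) j) (at (snd p))))"
      using comp[OF c \<Phi>'(1) M] dc unfolding split_beta by (intro continuous_intros) auto
    \<comment> \<open>The chain rule is available for times in \<open>{0..1}\<close> only, so
      continuity is carried over by agreement on that set.\<close>
    moreover have "vector_derivative (\<lambda>s. \<Phi> t (\<Gamma> t j s)) (at s) = \<Phi>' t (\<Gamma> t j s) (vector_derivative (\<Gamma> t j) (at s))"
      if t: "t \<in> {0..1}" for t s
    proof (rule vector_derivative_at, rule has_vector_derivative_image[OF _ \<Phi>'(2)[OF t M[OF t]] \<Gamma>(2)[OF t j]])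
      show "(\<Gamma> t j has_vector_derivative vector_derivative (\<Gamma> t j) (at s)) (at s)"
        using \<Gamma>(1)[OF t j] unfolding regular_closed_curve_def C1_differentiable_on_def
        by (metis UNIV_I vector_derivative_at)
    qed
    ultimately show "continuous_on ({0..1} \<times> UNIV) (\<lambda>(t, s). vector_derivative (\<lambda>s. \<Phi> t (\<Gamma> t j s)) (at s))"
      by (auto simp: split_beta elim!: continuous_on_eq)
  next
    fix i assume i: "i < k"
    have c: "continuous_on ({0..1} \<times> cball 0 1) (\<lambda>(t, z). \<Delta> t i z)"
      using iso i by (auto simp: pl_isotopy_def)
    obtain d' :: "real \<Rightarrow> complex \<Rightarrow> complex \<Rightarrow>\<^sub>L 'a" where d':
      "continuous_on ({0..1} \<times> cball 0 1) (\<lambda>(t, z). d' t z)"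
      "\<And>t z. t \<in> {0..1} \<Longrightarrow> z \<in> cball 0 1 \<Longrightarrow>
        (\<Delta> t i has_derivative blinfun_apply (d' t z)) (at z within cball 0 1)"
      using iso i unfolding pl_isotopy_def by blast
    have M: "\<Delta> t i z \<in> M" if "t \<in> {0..1}" "z \<in> cball 0 1" for t z using \<Delta>(2)[OF that(1) i] that(2) by blast
    show "continuous_on ({0..1} \<times> cball 0 1) (\<lambda>(t, z). \<Phi> t (\<Delta> t i z))"
      by (rule comp[OF c cont M])
    show "\<exists>d' :: real \<Rightarrow> complex \<Rightarrow> complex \<Rightarrow>\<^sub>L 'b.
            continuous_on ({0..1} \<times> cball 0 1) (\<lambda>(t, z). d' t z) \<and>
            (\<forall>t\<in>{0..1}. \<forall>z\<in>cball 0 1.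
               ((\<lambda>z. \<Phi> t (\<Delta> t i z)) has_derivative blinfun_apply (d' t z)) (at z within cball 0 1))"
    proof (intro exI[of _ "\<lambda>t z. \<Phi>' t (\<Delta> t i z) o\<^sub>L d' t z"] conjI ballI)
      show "continuous_on ({0..1} \<times> cball 0 1) (\<lambda>(t, z). \<Phi>' t (\<Delta> t i z) o\<^sub>L d' t z)"
        using comp[OF c \<Phi>'(1) M] d'(1) unfolding split_beta
        by (intro bounded_bilinear.continuous_on[OF bounded_bilinear_blinfun_compose])
      show "((\<lambda>z. \<Phi> t (\<Delta> t i z)) has_derivative blinfun_apply (\<Phi>' t (\<Delta> t i z) o\<^sub>L d' t z)) (at z within cball 0 1)"
        if "t \<in> {0..1}" "z \<in> cball 0 1" for t z
        using has_derivative_in_compose[OF d'(2)[OF that] has_derivative_subset[OF \<Phi>'(2)[OF that(1) M[OF that]] \<Delta>(2)[OF that(1) i]]]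
        by (simp add: blinfun_compose.rep_eq o_def)
    qed
  qed
qed

lemma isotopy_step_image:
  assumes "C1_embedding_family M N \<Phi>" "pl_isotopy M n k \<Gamma> \<Delta>"
  shows "(pl_image (\<Phi> 0) (pl_trace n k (\<Gamma> 0) (\<Delta> 0)), pl_image (\<Phi> 1) (pl_trace n k (\<Gamma> 1) (\<Delta> 1))) \<in> isotopy_step N"
  using pl_isotopy_image[OF assms] unfolding isotopy_step_def pl_trace_image[symmetric] by blast

text \<open>The track of \<open>P\<close> under the family is the image of the constant isotopy at
  \<open>P\<close>.\<close>

lemma isotopic_image_family:
  assumes "C1_embedding_family M N \<Phi>" "P \<in> pseudo_links M"
  shows "(pl_image (\<Phi> 0) P, pl_image (\<Phi> 1) P) \<in> isotopic N"
proof -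
  obtain n k \<Gamma> \<Delta> where "pseudo_link_param M n k \<Gamma> \<Delta>" and P: "P = pl_trace n k \<Gamma> \<Delta>"
    using assms(2) by (auto simp: pseudo_links_def)
  from isotopy_step_image[OF assms(1) pl_isotopy_const[OF this(1)]]
  show ?thesis unfolding P isotopic_def by (rule r_into_trancl)
qed

lemma trancl_map:
  assumes "(x, y) \<in> R\<^sup>+" "\<And>x y. (x, y) \<in> R \<Longrightarrow> (f x, f y) \<in> S"
  shows "(f x, f y) \<in> S\<^sup>+"
  using assms(1) by (induction rule: trancl_induct) (auto intro: assms(2) trancl_into_trancl)

lemma isotopic_image:
  assumes "C1_embedding M N f" "(P, Q) \<in> isotopic M"
  shows "(pl_image f P, pl_image f Q) \<in> isotopic N"
  using assms(2) unfolding isotopic_def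
proof (rule trancl_map)
  show "(pl_image f P, pl_image f Q) \<in> isotopy_step N" if "(P, Q) \<in> isotopy_step M" for P Q
    using that isotopy_step_image[OF C1_embedding_family_const[OF assms(1)]]
    by (auto simp: isotopy_step_def)
qed

section \<open>Adjoining a fixed link\<close>

lemma lessThan_add: "{..<m + n} = {..<m} \<union> (\<lambda>j. m + j) ` {..<n :: nat}"
proof -
  have "j \<in> (\<lambda>j. m + j) ` {..<n}" if "j < m + n" "\<not> j < m" for j
    using that by (intro image_eqI[of _ _ "j - m"]) auto
  then show ?thesis by auto
qed

text \<open>The fixed link is a pseudo link with \<open>k = 0\<close>, so its disc map is a
  placeholder indexed by nothing. \<open>no_disc\<close> is the geometric input that excludes discs
  lying over fixed strands only.\<close>

locale fixed_link =
  fixes \<F> :: "(complex \<times> complex) set set" and m :: nat and c :: "nat \<Rightarrow> real \<Rightarrow> complex \<times> complex"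
  assumes param: "pseudo_link_param S3 m 0 c (\<lambda>_ _. 0)"
    and \<F>_eq: "\<F> = (\<lambda>j. range (c j)) ` {..<m}"
    and no_disc: "embedded_disc d \<Longrightarrow> \<not> d ` cross \<subseteq> \<Union>\<F>"
begin

definition W :: "(complex \<times> complex) set" where
  "W = S3 - \<Union>\<F>"

definition adjoin :: "(nat \<Rightarrow> real \<Rightarrow> complex \<times> complex) \<Rightarrow> nat \<Rightarrow> real \<Rightarrow> complex \<times> complex" where
  "adjoin \<Gamma> j = (if j < m then c j else \<Gamma> (j - m))"

definition adjoin_fixed :: "(complex \<times> complex) pseudo_link \<Rightarrow> (complex \<times> complex) pseudo_link" where
  "adjoin_fixed P = (\<F> \<union> fst P, snd P)"

definition remove_fixed :: "(complex \<times> complex) pseudo_link \<Rightarrow> (complex \<times> complex) pseudo_link" where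
  "remove_fixed P = (fst P - \<F>, snd P)"

lemma mixed_representation_eq: "mixed_representation \<F> h P = adjoin_fixed (pl_image h P)"
  by (cases P) (simp add: mixed_representation_def adjoin_fixed_def pl_image_def)

lemma c_in: "j < m \<Longrightarrow> c j s \<in> \<Union>\<F>"
  by (auto simp: \<F>_eq)

text \<open>Curves and discs in \<open>W\<close> are disjoint from the fixed circles, so adjoining
  these creates no new coincidence.\<close>

lemma pseudo_link_param_adjoin:
  assumes p: "pseudo_link_param W n k \<Gamma> \<Delta>"
  shows "pseudo_link_param S3 (m + n) k (adjoin \<Gamma>) \<Delta>"
proof -
  note \<Gamma> = pseudo_link_paramD(2,3)[OF p]
  note \<Delta> = pseudo_link_paramD(4,5)[OF p]
  note c = pseudo_link_paramD(2,3)[OF param]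
  have WS: "W \<subseteq> S3" "W \<inter> \<Union>\<F> = {}" by (auto simp: W_def)
  have \<Delta>0: "\<Delta> i 0 \<in> W" if "i < k" for i using \<Delta>(2)[OF that] by auto
  have U: "(\<Union>j<m + n. range (adjoin \<Gamma> j)) = \<Union>\<F> \<union> (\<Union>j<n. range (\<Gamma> j))"
  proof -
    have "(\<Union>j<m + n. range (adjoin \<Gamma> j)) = (\<Union>j<m. range (c j)) \<union> (\<Union>j<n. range (\<Gamma> j))"
      unfolding lessThan_add by (simp add: adjoin_def)
    then show ?thesis by (simp add: \<F>_eq)
  qed
  show ?thesis
    unfolding pseudo_link_param_def
  proof (intro conjI allI impI)
    show "0 < m + n" using p by (simp add: pseudo_link_param_def)
    show "regular_closed_curve (adjoin \<Gamma> j)" "range (adjoin \<Gamma> j) \<subseteq> S3" if "j < m + n" for j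
      using c[of j] \<Gamma>(1)[of "j - m"] subset_trans[OF \<Gamma>(2) WS(1), of "j - m"] that
      by (cases "j < m"; simp add: adjoin_def)+
    show "embedded_disc (\<Delta> i)" "\<Delta> i ` cball 0 1 \<subseteq> S3" if "i < k" for i
      using \<Delta>[OF that] WS by auto
    show "disjoint_family_on (\<lambda>i. \<Delta> i ` cball 0 1) {..<k}"
      using p by (simp add: pseudo_link_param_def)
    show "\<Delta> i ` cball 0 1 \<inter> (\<Union>j<m + n. range (adjoin \<Gamma> j)) = \<Delta> i ` cross" if i: "i < k" for i
    proof -
      have "\<Delta> i ` cball 0 1 \<inter> \<Union>\<F> = {}" using \<Delta>(2)[OF i] WS(2) by blast
      then show ?thesis unfolding U Int_Un_distrib pseudo_link_paramD(6)[OF p i] by simp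
    qed
    show "card {(j, s). j < m + n \<and> s \<in> {0..<1} \<and> adjoin \<Gamma> j s = \<Delta> i 0} = 2" if i: "i < k" for i
    proof -
      let ?A = "{(j, s). j < n \<and> s \<in> {0..<1} \<and> \<Gamma> j s = \<Delta> i 0}"
      let ?B = "{(j, s). j < m + n \<and> s \<in> {0..<1} \<and> adjoin \<Gamma> j s = \<Delta> i 0}"
      \<comment> \<open>The centre lies in \<open>W\<close>, so no fixed curve passes through it;
        the two strands are the old ones with shifted index.\<close>
      have "?B = (\<lambda>(j, s). (m + j, s)) ` ?A"
      proof (intro set_eqI iffI)
        fix x assume "x \<in> ?B"
        then obtain j s where x: "x = (j, s)" "j < m + n" "s \<in> {0..<1}" "adjoin \<Gamma> j s = \<Delta> i 0" by blast
        have "\<not> j < m" using x(4) c_in[of j s] \<Delta>0[OF i] WS(2) by (auto simp: adjoin_def)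
        then show "x \<in> (\<lambda>(j, s). (m + j, s)) ` ?A"
          using x by (intro image_eqI[of _ _ "(j - m, s)"]) (auto simp: adjoin_def)
      qed (auto simp: adjoin_def)
      moreover have "inj_on (\<lambda>(j, s). (m + j, s)) ?A" by (auto simp: inj_on_def)
      moreover have "card ?A = 2" using p i by (simp add: pseudo_link_param_def)
      ultimately show ?thesis by (simp only: card_image)
    qed
    have injc: "inj_on (\<lambda>(j, s). c j s) {(j, s). j < m \<and> s \<in> {0..<1}}"
      using param by (simp add: pseudo_link_param_def)
    have inj\<Gamma>: "inj_on (\<lambda>(j, s). \<Gamma> j s) {(j, s). j < n \<and> s \<in> {0..<1} \<and> \<Gamma> j s \<notin> (\<lambda>i. \<Delta> i 0) ` {..<k}}"
      using p by (simp add: pseudo_link_param_def)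
    show "inj_on (\<lambda>(j, s). adjoin \<Gamma> j s)
      {(j, s). j < m + n \<and> s \<in> {0..<1} \<and> adjoin \<Gamma> j s \<notin> (\<lambda>i. \<Delta> i 0) ` {..<k}}"
    proof (rule inj_onI, clarify)
      fix i s j u
      assume i: "i < m + n" "s \<in> {0..<1}" "adjoin \<Gamma> i s \<notin> (\<lambda>i. \<Delta> i 0) ` {..<k}"
        and j: "j < m + n" "u \<in> {0..<1}" and eq: "adjoin \<Gamma> i s = adjoin \<Gamma> j u"
      \<comment> \<open>The position of a point tells whether its curve is fixed, so equal points
        come from the same block of indices and the injectivity of that block applies.\<close>
      have iff: "adjoin \<Gamma> i s \<in> \<Union>\<F> \<longleftrightarrow> i < m" if "i < m + n" for i s
      proof (cases "i < m")
        case False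
        then have "i - m < n" using that by linarith
        then have "\<Gamma> (i - m) s \<in> W" using \<Gamma>(2) by blast
        then show ?thesis using False WS by (auto simp: adjoin_def)
      qed (simp only: adjoin_def c_in if_True)
      have ij: "i < m \<longleftrightarrow> j < m" using iff[OF i(1), of s] iff[OF j(1), of u] eq by simp
      show "i = j \<and> s = u"
      proof (cases "i < m")
        case True
        then have "(i, s) = (j, u)"
          using ij eq i j by (intro inj_onD[OF injc]) (auto simp: adjoin_def)
        then show ?thesis by simp
      next
        case False
        then have "(i - m, s) = (j - m, u)"
          using ij eq i j by (intro inj_onD[OF inj\<Gamma>]) (auto simp: adjoin_def)
        then show ?thesis using False ij by auto
      qed
    qed
  qed
qed

lemma pl_trace_adjoin: "pl_trace (m + n) k (adjoin \<Gamma>) \<Delta> = adjoin_fixed (pl_trace n k \<Gamma> \<Delta>)"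
  unfolding pl_trace_def adjoin_fixed_def lessThan_add
  by (simp add: \<F>_eq image_Un image_image adjoin_def)

lemma pseudo_links_W:
  assumes "P \<in> pseudo_links W"
  shows "fst P \<noteq> {}" "fst P \<inter> \<F> = {}" "\<And>D. D \<in> snd P \<Longrightarrow> D \<subseteq> W"
proof -
  obtain n k \<Gamma> \<Delta> where p: "pseudo_link_param W n k \<Gamma> \<Delta>" and P: "P = pl_trace n k \<Gamma> \<Delta>"
    using assms by (auto simp: pseudo_links_def)
  note \<Gamma> = pseudo_link_paramD(3)[OF p] and \<Delta> = pseudo_link_paramD(5)[OF p]
  show "fst P \<noteq> {}" using pseudo_link_paramD(1)[OF p] by (simp add: P pl_trace_def lessThan_empty_iff)
  show "D \<subseteq> W" if "D \<in> snd P" for D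
    using that \<Delta> unfolding P pl_trace_def snd_conv by blast
  have "C \<subseteq> W \<and> C \<noteq> {}" if "C \<in> fst P" for C
    using that \<Gamma> unfolding P pl_trace_def fst_conv by blast
  then show "fst P \<inter> \<F> = {}" unfolding W_def by blast
qed

lemma remove_adjoin_fixed: "P \<in> pseudo_links W \<Longrightarrow> remove_fixed (adjoin_fixed P) = P"
  using pseudo_links_W(2)[of P] by (auto simp: remove_fixed_def adjoin_fixed_def prod_eq_iff)

lemma adjoin_remove_fixed: "P \<in> mixed_pseudo_links \<F> \<Longrightarrow> adjoin_fixed (remove_fixed P) = P"
  by (auto simp: remove_fixed_def adjoin_fixed_def mixed_pseudo_links_def)

lemma adjoin_fixed_mixed:
  assumes P: "P \<in> pseudo_links W"
  shows "adjoin_fixed P \<in> mixed_pseudo_links \<F>"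
proof -
  obtain n k \<Gamma> \<Delta> where p: "pseudo_link_param W n k \<Gamma> \<Delta>" and P': "P = pl_trace n k \<Gamma> \<Delta>"
    using P by (auto simp: pseudo_links_def)
  have "adjoin_fixed P \<in> pseudo_links S3"
    unfolding P' pl_trace_adjoin[symmetric] pseudo_links_def
    using pseudo_link_param_adjoin[OF p] by blast
  moreover have "\<F> \<subset> \<F> \<union> fst P" using pseudo_links_W(1,2)[OF P] by blast
  moreover have "D \<inter> \<Union>\<F> = {}" if "D \<in> snd P" for D
    using pseudo_links_W(3)[OF P that] by (auto simp: W_def)
  ultimately show ?thesis by (simp add: mixed_pseudo_links_def adjoin_fixed_def)
qed

lemma pl_isotopy_adjoin:
  assumes iso: "pl_isotopy W n k \<Gamma> \<Delta>"
  shows "pl_isotopy S3 (m + n) k (\<lambda>t. adjoin (\<Gamma> t)) \<Delta>"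
proof -
  have c: "pl_isotopy S3 m 0 (\<lambda>_. c) (\<lambda>_ _ _. 0)" by (rule pl_isotopy_const[OF param])
  show ?thesis
    unfolding pl_isotopy_def
  proof (intro conjI ballI allI impI)
    show "pseudo_link_param S3 (m + n) k (adjoin (\<Gamma> t)) (\<Delta> t)" if "t \<in> {0..1}" for t
      by (rule pseudo_link_param_adjoin) (use iso that in \<open>simp add: pl_isotopy_def\<close>)
    show "continuous_on ({0..1} \<times> UNIV) (\<lambda>(t, s). adjoin (\<Gamma> t) j s)"
      "continuous_on ({0..1} \<times> UNIV) (\<lambda>(t, s). vector_derivative (adjoin (\<Gamma> t) j) (at s))"
      if "j < m + n" for j
      using iso c that by (cases "j < m"; simp add: adjoin_def pl_isotopy_def)+
  qed (use iso in \<open>simp_all add: pl_isotopy_def\<close>)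
qed

lemma adjoin_fixed_isotopic:
  assumes "(P, Q) \<in> isotopic W"
  shows "(adjoin_fixed P, adjoin_fixed Q) \<in> mixed_isotopic \<F>"
  using assms unfolding isotopic_def mixed_isotopic_def
proof (rule trancl_map)
  fix P Q assume "(P, Q) \<in> isotopy_step W"
  then obtain n k \<Gamma> \<Delta> where iso: "pl_isotopy W n k \<Gamma> \<Delta>"
    and PQ: "P = pl_trace n k (\<Gamma> 0) (\<Delta> 0)" "Q = pl_trace n k (\<Gamma> 1) (\<Delta> 1)"
    by (auto simp: isotopy_step_def)
  have p: "pseudo_link_param W n k (\<Gamma> t) (\<Delta> t)" if "t \<in> {0..1}" for t
    using iso that by (simp add: pl_isotopy_def)
  have mixed: "pl_trace (m + n) k (adjoin (\<Gamma> t)) (\<Delta> t) \<in> mixed_pseudo_links \<F>" if "t \<in> {0..1}" for t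
    unfolding pl_trace_adjoin
    by (rule adjoin_fixed_mixed) (use p[OF that] in \<open>auto simp: pseudo_links_def\<close>)
  \<comment> \<open>A mixed isotopy must be constant on every curve that starts as a fixed
    component. Moving curves lie in \<open>W\<close>, so only the adjoined ones start there, and
    these are constant by construction.\<close>
  have "j < m" if "j < m + n" "range (adjoin (\<Gamma> 0) j) \<in> \<F>" for j
  proof (rule ccontr)
    assume j: "\<not> j < m"
    then have "range (\<Gamma> 0 (j - m)) \<subseteq> W"
      using that(1) by (intro pseudo_link_paramD(3)[OF p]) auto
    moreover have "range (\<Gamma> 0 (j - m)) \<in> \<F>" using that(2) j by (simp add: adjoin_def)
    ultimately show False by (auto simp: W_def)
  qed
  moreover have "adjoin (\<Gamma> t) j s = adjoin (\<Gamma> 0) j s" if "j < m" for t j s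
    using that by (simp add: adjoin_def)
  ultimately have fixd: "\<forall>j<m + n. range (adjoin (\<Gamma> 0) j) \<in> \<F> \<longrightarrow>
      (\<forall>t\<in>{0..1}. \<forall>s. adjoin (\<Gamma> t) j s = adjoin (\<Gamma> 0) j s)"
    by blast
  then show "(adjoin_fixed P, adjoin_fixed Q) \<in> mixed_isotopy_step \<F>"
    unfolding mixed_isotopy_step_def mem_Collect_eq case_prod_conv PQ pl_trace_adjoin[symmetric]
    by (intro exI[of _ "m + n"] exI[of _ k] exI[of _ "\<lambda>t. adjoin (\<Gamma> t)"] exI[of _ \<Delta>] conjI ballI
        pl_isotopy_adjoin[OF iso] mixed fixd refl)
qed

section \<open>Deleting the fixed link\<close>

text \<open>\<open>\<sigma>\<close> renumbers the surviving curves without gaps. It is a parameter,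
  not chosen inside, so that an isotopy can use the same numbering at all times.\<close>

lemma pseudo_link_param_remove:
  assumes p: "pseudo_link_param S3 n k \<Gamma> \<Delta>" and mixed: "pl_trace n k \<Gamma> \<Delta> \<in> mixed_pseudo_links \<F>"
    and \<sigma>: "bij_betw \<sigma> {..<n'} {j. j < n \<and> range (\<Gamma> j) \<notin> \<F>}"
  shows "pseudo_link_param W n' k (\<lambda>j. \<Gamma> (\<sigma> j)) \<Delta>"
    and "pl_trace n' k (\<lambda>j. \<Gamma> (\<sigma> j)) \<Delta> = remove_fixed (pl_trace n k \<Gamma> \<Delta>)"
proof -
  let ?J = "{j. j < n \<and> range (\<Gamma> j) \<notin> \<F>}"
  have \<sigma>J: "\<sigma> ` {..<n'} = ?J" and inj\<sigma>: "inj_on \<sigma> {..<n'}"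
    using \<sigma> by (auto simp: bij_betw_def)
  have \<sigma>n: "\<sigma> j < n" "range (\<Gamma> (\<sigma> j)) \<notin> \<F>" if "j < n'" for j
    using \<sigma>J that by blast+
  note \<Gamma> = pseudo_link_paramD(2,3)[OF p]
  note \<Delta> = pseudo_link_paramD(4-6)[OF p]
  let ?C = "(\<lambda>j. range (\<Gamma> j)) ` {..<n}"
  have sub: "\<F> \<subset> ?C" and sep: "\<And>i. i < k \<Longrightarrow>
      \<not> (\<Delta> i ` cball 0 1 \<inter> \<Union>\<F> \<noteq> {} \<and> \<Delta> i ` cball 0 1 \<inter> \<Union>(?C - \<F>) \<noteq> {})"
    using mixed by (auto simp: mixed_pseudo_links_def pl_trace_def)
  \<comment> \<open>A disc that meets the fixed link misses all other components. Its cross consists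
    of points of the link, hence would lie in the fixed circles, against
    \<open>no_disc\<close>.\<close>
  have \<Delta>\<F>: "\<Delta> i ` cball 0 1 \<inter> \<Union>\<F> = {}" if i: "i < k" for i
  proof (rule ccontr)
    assume "\<Delta> i ` cball 0 1 \<inter> \<Union>\<F> \<noteq> {}"
    then have disj: "\<Delta> i ` cball 0 1 \<inter> \<Union>(?C - \<F>) = {}" using sep[OF i] by blast
    have "x \<in> \<Union>\<F>" if "x \<in> \<Delta> i ` cross" for x
    proof -
      have x: "x \<in> \<Delta> i ` cball 0 1" "x \<in> \<Union>?C"
        using that unfolding \<Delta>(3)[OF i, symmetric] by simp_all
      then have "x \<notin> \<Union>(?C - \<F>)" using disj by blast
      with x(2) show ?thesis by blast
    qed
    then have "\<Delta> i ` cross \<subseteq> \<Union>\<F>" by blast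
    with no_disc[OF \<Delta>(1)[OF i]] show False by blast
  qed
  have centre: "\<Delta> i 0 \<notin> \<Union>\<F>" if "i < k" for i
  proof -
    have "\<Delta> i 0 \<in> \<Delta> i ` cball 0 1" by simp
    with \<Delta>\<F>[OF that] show ?thesis by blast
  qed
  have inj: "inj_on (\<lambda>(j, s). \<Gamma> j s) {(j, s). j < n \<and> s \<in> {0..<1} \<and> \<Gamma> j s \<notin> (\<lambda>i. \<Delta> i 0) ` {..<k}}"
    using p by (simp add: pseudo_link_param_def)
  \<comment> \<open>Away from the disc centres the parametrisation is injective, and no centre lies
    on the fixed link; so a common point would make the two curves equal. \<open>frac\<close> moves
    the parameters into the fundamental domain \<open>{0..<1}\<close>, where injectivity is
    stated.\<close>
  have \<Gamma>\<F>: "range (\<Gamma> j) \<inter> \<Union>\<F> = {}" if j: "j < n" "range (\<Gamma> j) \<notin> \<F>" for j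
  proof (rule ccontr)
    assume "range (\<Gamma> j) \<inter> \<Union>\<F> \<noteq> {}"
    then obtain s f where s: "\<Gamma> j s \<in> f" "f \<in> \<F>" by blast
    then obtain i where i: "i < n" "f = range (\<Gamma> i)" using sub by blast
    then obtain u where u: "\<Gamma> j s = \<Gamma> i u" using s by blast
    have eq: "\<Gamma> j (frac s) = \<Gamma> j s" "\<Gamma> i (frac u) = \<Gamma> j s"
      using regular_closed_curve_frac[OF \<Gamma>(1)] j i u by auto
    have "\<Gamma> j s \<notin> (\<lambda>i. \<Delta> i 0) ` {..<k}" using centre s by auto
    then have "(j, frac s) = (i, frac u)"
      by (intro inj_onD[OF inj]) (use eq i j in \<open>auto simp: frac_lt_1\<close>)
    then show False using i s j by simp
  qed
  have U: "(\<Union>j<n'. range (\<Gamma> (\<sigma> j))) = (\<Union>j\<in>?J. range (\<Gamma> j))"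
    unfolding \<sigma>J[symmetric] by simp
  have U': "(\<Union>j<n. range (\<Gamma> j)) \<subseteq> (\<Union>j\<in>?J. range (\<Gamma> j)) \<union> \<Union>\<F>" by blast
  show "pseudo_link_param W n' k (\<lambda>j. \<Gamma> (\<sigma> j)) \<Delta>"
    unfolding pseudo_link_param_def
  proof (intro conjI allI impI)
    \<comment> \<open>This is where the moving part being nonempty enters, through the strict
      inclusion in \<open>mixed_pseudo_links\<close>.\<close>
    obtain j where "j < n" "range (\<Gamma> j) \<notin> \<F>" using sub by blast
    then have "{..<n'} \<noteq> {}" using \<sigma>J by blast
    then show "0 < n'" by auto
    show "regular_closed_curve (\<Gamma> (\<sigma> j))" if "j < n'" for j
      by (rule \<Gamma>(1)[OF \<sigma>n(1)[OF that]])
    show "range (\<Gamma> (\<sigma> j)) \<subseteq> W" if "j < n'" for j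
      using \<Gamma>(2)[OF \<sigma>n(1)[OF that]] \<Gamma>\<F>[OF \<sigma>n[OF that]] unfolding W_def by blast
    show "embedded_disc (\<Delta> i)" if "i < k" for i by (rule \<Delta>(1)[OF that])
    show "\<Delta> i ` cball 0 1 \<subseteq> W" if "i < k" for i
      using \<Delta>(2)[OF that] \<Delta>\<F>[OF that] unfolding W_def by blast
    show "disjoint_family_on (\<lambda>i. \<Delta> i ` cball 0 1) {..<k}"
      using p by (simp add: pseudo_link_param_def)
    show "\<Delta> i ` cball 0 1 \<inter> (\<Union>j<n'. range (\<Gamma> (\<sigma> j))) = \<Delta> i ` cross" if "i < k" for i
    proof -
      have "\<Delta> i ` cball 0 1 \<inter> (\<Union>j\<in>?J. range (\<Gamma> j)) = \<Delta> i ` cball 0 1 \<inter> (\<Union>j<n. range (\<Gamma> j))"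
      proof (intro equalityI subsetI)
        fix x assume x: "x \<in> \<Delta> i ` cball 0 1 \<inter> (\<Union>j<n. range (\<Gamma> j))"
        then have "x \<notin> \<Union>\<F>" using \<Delta>\<F>[OF that] by blast
        with x U' show "x \<in> \<Delta> i ` cball 0 1 \<inter> (\<Union>j\<in>?J. range (\<Gamma> j))" by blast
      qed auto
      then show ?thesis unfolding U \<Delta>(3)[OF that] .
    qed
    show "card {(j, s). j < n' \<and> s \<in> {0..<1} \<and> \<Gamma> (\<sigma> j) s = \<Delta> i 0} = 2" if i: "i < k" for i
    proof -
      let ?A = "{(j, s). j < n' \<and> s \<in> {0..<1} \<and> \<Gamma> (\<sigma> j) s = \<Delta> i 0}"
      let ?B = "{(j, s). j < n \<and> s \<in> {0..<1} \<and> \<Gamma> j s = \<Delta> i 0}"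
      have "?B = (\<lambda>(j, s). (\<sigma> j, s)) ` ?A"
      proof (intro set_eqI iffI)
        fix x assume "x \<in> ?B"
        then obtain j s where x: "x = (j, s)" "j < n" "s \<in> {0..<1}" "\<Gamma> j s = \<Delta> i 0" by blast
        have "range (\<Gamma> j) \<notin> \<F>" using centre[OF i] x(4) by (metis UnionI rangeI)
        then have "j \<in> \<sigma> ` {..<n'}" using \<sigma>J x by blast
        then obtain l where "l < n'" "j = \<sigma> l" by blast
        then show "x \<in> (\<lambda>(j, s). (\<sigma> j, s)) ` ?A"
          using x by (intro image_eqI[of _ _ "(l, s)"]) auto
      qed (auto simp: \<sigma>n)
      moreover have "inj_on (\<lambda>(j, s). (\<sigma> j, s)) ?A"
        using inj\<sigma> by (auto simp: inj_on_def)
      moreover have "card ?B = 2" using p i by (simp add: pseudo_link_param_def)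
      ultimately show ?thesis by (simp only: card_image)
    qed
    show "inj_on (\<lambda>(j, s). \<Gamma> (\<sigma> j) s)
      {(j, s). j < n' \<and> s \<in> {0..<1} \<and> \<Gamma> (\<sigma> j) s \<notin> (\<lambda>i. \<Delta> i 0) ` {..<k}}"
    proof (rule inj_onI, clarify)
      fix i s j u
      assume i: "i < n'" "s \<in> {0..<1}" "\<Gamma> (\<sigma> i) s \<notin> (\<lambda>i. \<Delta> i 0) ` {..<k}"
        and j: "j < n'" "u \<in> {0..<1}" and eq: "\<Gamma> (\<sigma> i) s = \<Gamma> (\<sigma> j) u"
      then have "(\<sigma> i, s) = (\<sigma> j, u)"
        by (intro inj_onD[OF inj]) (auto simp: \<sigma>n)
      then show "i = j \<and> s = u" using inj_onD[OF inj\<sigma>] i j by simp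
    qed
  qed
  have "(\<lambda>j. range (\<Gamma> (\<sigma> j))) ` {..<n'} = (\<lambda>j. range (\<Gamma> j)) ` ?J"
    unfolding \<sigma>J[symmetric] by (simp add: image_image)
  also have "\<dots> = ?C - \<F>" by blast
  finally show "pl_trace n' k (\<lambda>j. \<Gamma> (\<sigma> j)) \<Delta> = remove_fixed (pl_trace n k \<Gamma> \<Delta>)"
    by (simp add: pl_trace_def remove_fixed_def)
qed

text \<open>The indices of the fixed components are the same at all times, so one renumbering
  \<open>\<sigma>\<close> serves the whole path and continuity is inherited curve by curve.\<close>

lemma remove_fixed_isotopy_step:
  assumes "(P, Q) \<in> mixed_isotopy_step \<F>"
  shows "(remove_fixed P, remove_fixed Q) \<in> isotopy_step W"
proof -
  obtain n k \<Gamma> \<Delta> where iso: "pl_isotopy S3 n k \<Gamma> \<Delta>"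
    and mixed: "\<And>t. t \<in> {0..1} \<Longrightarrow> pl_trace n k (\<Gamma> t) (\<Delta> t) \<in> mixed_pseudo_links \<F>"
    and fixd: "\<And>j t s. j < n \<Longrightarrow> range (\<Gamma> 0 j) \<in> \<F> \<Longrightarrow> t \<in> {0..1} \<Longrightarrow> \<Gamma> t j s = \<Gamma> 0 j s"
    and PQ: "P = pl_trace n k (\<Gamma> 0) (\<Delta> 0)" "Q = pl_trace n k (\<Gamma> 1) (\<Delta> 1)"
    using assms unfolding mixed_isotopy_step_def by blast
  have p: "pseudo_link_param S3 n k (\<Gamma> t) (\<Delta> t)" if "t \<in> {0..1}" for t
    using iso that by (simp add: pl_isotopy_def)
  have fixd': "\<Gamma> t j = \<Gamma> 0 j" if "j < n" "range (\<Gamma> 0 j) \<in> \<F>" "t \<in> {0..1}" for t j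
    using fixd[OF that] by (rule ext)
  \<comment> \<open>If curve \<open>j\<close> occupies a fixed component at time \<open>t\<close>,
    then so does the curve \<open>i\<close> that was there at time 0, as it never moved. Distinct
    indices have distinct ranges, hence \<open>i = j\<close>.\<close>
  have iff: "range (\<Gamma> t j) \<in> \<F> \<longleftrightarrow> range (\<Gamma> 0 j) \<in> \<F>" if j: "j < n" and t: "t \<in> {0..1}" for t j
  proof
    assume "range (\<Gamma> t j) \<in> \<F>"
    moreover have "\<F> \<subseteq> (\<lambda>j. range (\<Gamma> 0 j)) ` {..<n}"
      using mixed[of 0] by (auto simp: mixed_pseudo_links_def pl_trace_def)
    ultimately obtain i where i: "i < n" "range (\<Gamma> t j) = range (\<Gamma> 0 i)" "range (\<Gamma> 0 i) \<in> \<F>" by auto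
    then have "range (\<Gamma> t i) = range (\<Gamma> t j)" using fixd'[OF i(1,3) t] by simp
    then have "i = j" by (rule pseudo_link_param_components_distinct[OF p[OF t] i(1) j])
    then show "range (\<Gamma> 0 j) \<in> \<F>" using i by simp
  qed (use fixd'[OF j _ t] in simp)
  obtain \<sigma> where "bij_betw \<sigma> {..<card {j. j < n \<and> range (\<Gamma> 0 j) \<notin> \<F>}} {j. j < n \<and> range (\<Gamma> 0 j) \<notin> \<F>}"
    using ex_bij_betw_nat_finite[of "{j. j < n \<and> range (\<Gamma> 0 j) \<notin> \<F>}"] by (auto simp: lessThan_atLeast0)
  then obtain n' where \<sigma>0: "bij_betw \<sigma> {..<n'} {j. j < n \<and> range (\<Gamma> 0 j) \<notin> \<F>}" by blast
  have J: "{j. j < n \<and> range (\<Gamma> t j) \<notin> \<F>} = {j. j < n \<and> range (\<Gamma> 0 j) \<notin> \<F>}" if "t \<in> {0..1}" for t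
    using iff that by blast
  have \<sigma>: "bij_betw \<sigma> {..<n'} {j. j < n \<and> range (\<Gamma> t j) \<notin> \<F>}" if "t \<in> {0..1}" for t
    unfolding J[OF that] by (rule \<sigma>0)
  have \<sigma>n: "\<sigma> j < n" if "j < n'" for j
    using bij_betwE[OF \<sigma>[of 0]] that by auto
  note remove = pseudo_link_param_remove[OF p mixed \<sigma>]
  have "pl_isotopy W n' k (\<lambda>t j. \<Gamma> t (\<sigma> j)) \<Delta>"
    unfolding pl_isotopy_def
  proof (intro conjI ballI allI impI)
    show "pseudo_link_param W n' k (\<lambda>j. \<Gamma> t (\<sigma> j)) (\<Delta> t)" if "t \<in> {0..1}" for t
      by (rule remove(1)[OF that that that])
    show "continuous_on ({0..1} \<times> UNIV) (\<lambda>(t, s). \<Gamma> t (\<sigma> j) s)"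
      "continuous_on ({0..1} \<times> UNIV) (\<lambda>(t, s). vector_derivative (\<Gamma> t (\<sigma> j)) (at s))" if "j < n'" for j
      using iso \<sigma>n[OF that] by (simp_all add: pl_isotopy_def)
  qed (use iso in \<open>simp_all add: pl_isotopy_def\<close>)
  moreover have "remove_fixed P = pl_trace n' k (\<lambda>j. \<Gamma> 0 (\<sigma> j)) (\<Delta> 0)"
    "remove_fixed Q = pl_trace n' k (\<lambda>j. \<Gamma> 1 (\<sigma> j)) (\<Delta> 1)"
    unfolding PQ by (rule remove(2)[symmetric]; simp)+
  ultimately show ?thesis
    unfolding isotopy_step_def mem_Collect_eq case_prod_conv
    by (intro exI[of _ n'] exI[of _ k] exI[of _ "\<lambda>t j. \<Gamma> t (\<sigma> j)"] exI[of _ \<Delta>] conjI)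
qed

text \<open>Read off from reflexivity: deletion maps the mixed isotopy from \<open>P\<close> to
  itself to an isotopy in \<open>W\<close>, and that relation lives on the pseudo links of
  \<open>W\<close>.\<close>

lemma remove_fixed_pseudo_links:
  assumes "P \<in> mixed_pseudo_links \<F>"
  shows "remove_fixed P \<in> pseudo_links W"
proof -
  have "(P, P) \<in> mixed_isotopic \<F>"
    using equiv_mixed_isotopic assms by (simp add: equiv_def refl_on_def)
  then have "(remove_fixed P, remove_fixed P) \<in> isotopic W"
    unfolding isotopic_def mixed_isotopic_def
    by (rule trancl_map) (rule remove_fixed_isotopy_step)
  then show ?thesis using equiv_isotopic[of W] by (auto simp: equiv_def)
qed

lemma adjoin_fixed_isotopic_iff:
  assumes "P \<in> pseudo_links W" "Q \<in> pseudo_links W"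
  shows "(adjoin_fixed P, adjoin_fixed Q) \<in> mixed_isotopic \<F> \<longleftrightarrow> (P, Q) \<in> isotopic W"
proof
  assume "(adjoin_fixed P, adjoin_fixed Q) \<in> mixed_isotopic \<F>"
  then have "(remove_fixed (adjoin_fixed P), remove_fixed (adjoin_fixed Q)) \<in> isotopic W"
    unfolding isotopic_def mixed_isotopic_def
    by (rule trancl_map) (rule remove_fixed_isotopy_step)
  then show "(P, Q) \<in> isotopic W" using assms by (simp add: remove_adjoin_fixed)
qed (rule adjoin_fixed_isotopic)

end

section \<open>Bijections on isotopy classes\<close>

text \<open>Surjectivity is asked only up to \<open>R\<close>: a mixed pseudo link near the unknot
  is merely isotopic to a representation. The forward half of \<open>iff\<close> gives injectivity,
  the backward half makes the union in \<open>class_map\<close> a single class.\<close>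

lemma bij_betw_class_map:
  assumes S: "equiv A S" and R: "equiv B R" and f: "\<And>x. x \<in> A \<Longrightarrow> f x \<in> B"
    and iff: "\<And>x y. x \<in> A \<Longrightarrow> y \<in> A \<Longrightarrow> (f x, f y) \<in> R \<longleftrightarrow> (x, y) \<in> S"
    and surj: "\<And>b. b \<in> B \<Longrightarrow> \<exists>a\<in>A. (f a, b) \<in> R"
  shows "bij_betw (class_map R f) (A // S) (B // R)"
proof -
  have cls: "class_map R f (S `` {x}) = R `` {f x}" if x: "x \<in> A" for x
  proof -
    have "R `` {f y} = R `` {f x}" if "(x, y) \<in> S" for y
    proof -
      have "y \<in> A" using S that by (auto simp: equiv_def)
      then show ?thesis using iff[OF x] that by (intro equiv_class_eq[OF R, symmetric]) simp
    qed
    moreover have "x \<in> S `` {x}" by (rule equiv_class_self[OF S x])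
    ultimately show ?thesis unfolding class_map_def by blast
  qed
  show ?thesis
    unfolding bij_betw_def
  proof
    show "inj_on (class_map R f) (A // S)"
    proof (rule inj_onI)
      fix X Y assume "X \<in> A // S" "Y \<in> A // S" and eq: "class_map R f X = class_map R f Y"
      then obtain x y where xy: "x \<in> A" "X = S `` {x}" "y \<in> A" "Y = S `` {y}" by (auto elim!: quotientE)
      then have "R `` {f x} = R `` {f y}" using eq cls by simp
      then have "(f x, f y) \<in> R" by (rule eq_equiv_class[OF _ R f[OF xy(3)]])
      then show "X = Y" using iff xy by (simp add: equiv_class_eq[OF S])
    qed
    show "class_map R f ` (A // S) = B // R"
    proof (intro equalityI subsetI)
      fix Z assume "Z \<in> class_map R f ` (A // S)"
      then obtain x where "x \<in> A" "Z = R `` {f x}" using cls by (auto elim!: quotientE)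
      then show "Z \<in> B // R" using f by (auto intro: quotientI)
    next
      fix Z assume "Z \<in> B // R"
      then obtain b where b: "b \<in> B" "Z = R `` {b}" by (auto elim!: quotientE)
      obtain a where a: "a \<in> A" "(f a, b) \<in> R" using surj[OF b(1)] by blast
      have "Z = class_map R f (S `` {a})" using b a equiv_class_eq[OF R a(2)] cls by simp
      then show "Z \<in> class_map R f ` (A // S)" using a(1) by (auto intro: quotientI)
    qed
  qed
qed

context fixed_link
begin

text \<open>
  The solid torus is only the complement of a neighbourhood of the fixed part; \<open>\<Phi>\<close> pushes links
  and isotopies off that neighbourhood.
\<close>

lemma bij_betw_mixed_representation:
  assumes h: "C1_diffeo X Y h" and Y: "Y \<subseteq> W"
    and \<Phi>: "C1_embedding_family W W \<Phi>" "\<And>x. x \<in> W \<Longrightarrow> \<Phi> 0 x = x" "\<Phi> 1 ` W \<subseteq> Y"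
    "\<And>t. t \<in> {0..1} \<Longrightarrow> \<Phi> t ` Y \<subseteq> Y"
  shows "bij_betw (class_map (mixed_isotopic \<F>) (mixed_representation \<F> h))
           (pseudo_links X // isotopic X) (mixed_pseudo_links \<F> // mixed_isotopic \<F>)"
proof (rule bij_betw_class_map[OF equiv_isotopic equiv_mixed_isotopic])
  define h' where "h' = inv_into X h"
  have bij: "bij_betw h X Y" using h by (simp add: C1_diffeo_def)
  have inv: "h' (h x) = x" if "x \<in> X" for x
    unfolding h'_def using bij that by (rule bij_betw_inv_into_left)
  have inv': "h (h' y) = y" if "y \<in> Y" for y
    unfolding h'_def using bij that by (rule bij_betw_inv_into_right)
  have hY: "C1_embedding X Y h" and h'X: "C1_embedding Y X h'"
    unfolding h'_def by (rule C1_diffeo_embedding[OF h])+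
  have hW: "C1_embedding X W h"
    by (rule C1_embedding_mono[OF hY subset_refl]) (use hY Y in \<open>auto simp: C1_embedding_def\<close>)
  have \<Phi>1: "C1_embedding W Y (\<Phi> 1)"
    by (rule C1_embedding_mono[of W W]) (use \<Phi>(1,3) in \<open>auto simp: C1_embedding_family_def\<close>)
  have \<Phi>Y: "C1_embedding_family Y Y \<Phi>"
    by (rule C1_embedding_family_mono[OF \<Phi>(1) Y \<Phi>(4)])
  show "mixed_representation \<F> h P \<in> mixed_pseudo_links \<F>" if "P \<in> pseudo_links X" for P
    unfolding mixed_representation_eq by (intro adjoin_fixed_mixed pl_image_pseudo_links[OF hW] that)
  show "(mixed_representation \<F> h P, mixed_representation \<F> h Q) \<in> mixed_isotopic \<F> \<longleftrightarrow> (P, Q) \<in> isotopic X"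
    if P: "P \<in> pseudo_links X" and Q: "Q \<in> pseudo_links X" for P Q
  proof -
    \<comment> \<open>The isotopy in \<open>W\<close> is mapped into \<open>Y\<close> by
      \<open>\<Phi> 1\<close>; each of its new ends is joined to the original link by the track of
      the family, which stays in \<open>Y\<close>. The inverse of \<open>h\<close> then brings
      everything back to \<open>X\<close>.\<close>
    have "(P, Q) \<in> isotopic X" if "(pl_image h P, pl_image h Q) \<in> isotopic W"
    proof -
      have \<Phi>id: "(pl_image h L, pl_image (\<Phi> 1) (pl_image h L)) \<in> isotopic Y" if "L \<in> pseudo_links X" for L
      proof -
        have hL: "pl_image h L \<in> pseudo_links Y" by (rule pl_image_pseudo_links[OF hY that])
        have "pl_image (\<Phi> 0) (pl_image h L) = pl_image h L"
          by (rule pl_image_ident[OF hL]) (use \<Phi>(2) Y in blast)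
        then show ?thesis using isotopic_image_family[OF \<Phi>Y hL] by simp
      qed
      note E = equiv_isotopic[of Y, unfolded equiv_def]
      have "(pl_image (\<Phi> 1) (pl_image h P), pl_image (\<Phi> 1) (pl_image h Q)) \<in> isotopic Y"
        by (rule isotopic_image[OF \<Phi>1 that])
      then have "(pl_image h P, pl_image h Q) \<in> isotopic Y"
        using \<Phi>id[OF P] \<Phi>id[OF Q] E by (meson symD transD)
      from isotopic_image[OF h'X this] show ?thesis
        unfolding pl_image_compose using pl_image_ident[OF P inv] pl_image_ident[OF Q inv] by simp
    qed
    then show ?thesis
      unfolding mixed_representation_eq
      using adjoin_fixed_isotopic_iff[OF pl_image_pseudo_links[OF hW P] pl_image_pseudo_links[OF hW Q]]
        isotopic_image[OF hW] by blast
  qed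
  show "\<exists>P\<in>pseudo_links X. (mixed_representation \<F> h P, L) \<in> mixed_isotopic \<F>"
    if L: "L \<in> mixed_pseudo_links \<F>" for L
  proof
    \<comment> \<open>The moving part of \<open>L\<close> need not lie in \<open>Y\<close>. Its
      pushed copy \<open>?K1\<close> does and can be pulled back to \<open>X\<close>; the track from
      \<open>?K\<close> to \<open>?K1\<close> in \<open>W\<close> becomes a mixed isotopy once the
      fixed part is adjoined.\<close>
    let ?K = "remove_fixed L"
    let ?K1 = "pl_image (\<Phi> 1) ?K"
    have K: "?K \<in> pseudo_links W" by (rule remove_fixed_pseudo_links[OF L])
    have K1: "?K1 \<in> pseudo_links Y" by (rule pl_image_pseudo_links[OF \<Phi>1 K])
    show "pl_image h' ?K1 \<in> pseudo_links X" by (rule pl_image_pseudo_links[OF h'X K1])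
    have "pl_image h (pl_image h' ?K1) = ?K1"
      unfolding pl_image_compose[of h h'] by (rule pl_image_ident[OF K1 inv'])
    moreover have "(?K, ?K1) \<in> isotopic W"
      using isotopic_image_family[OF \<Phi>(1) K] pl_image_ident[OF K, of "\<Phi> 0"] \<Phi>(2) by simp
    then have "(adjoin_fixed ?K1, L) \<in> mixed_isotopic \<F>"
      using adjoin_fixed_isotopic[of ?K1 ?K] adjoin_remove_fixed[OF L] equiv_isotopic[of W]
      by (simp add: equiv_def symD)
    ultimately show "(mixed_representation \<F> h (pl_image h' ?K1), L) \<in> mixed_isotopic \<F>"
      by (simp add: mixed_representation_eq)
  qed
qed

end

section \<open>Great circles\<close>

lemma regular_closed_curve_cis:
  assumes L: "bounded_linear L" "\<And>z. L z = 0 \<Longrightarrow> z = 0"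
  shows "regular_closed_curve (\<lambda>s. L (cis (2 * pi * s)))"
proof -
  have cis: "((\<lambda>s. cis (2 * pi * s)) has_vector_derivative (2 * pi) *\<^sub>R (\<i> * cis (2 * pi * s))) (at s)" for s
    unfolding has_vector_derivative_def by (auto intro!: derivative_eq_intros simp: mult_ac)
  have D: "((\<lambda>s. L (cis (2 * pi * s))) has_vector_derivative L ((2 * pi) *\<^sub>R (\<i> * cis (2 * pi * s)))) (at s)" for s
    by (rule bounded_linear.has_vector_derivative[OF L(1) cis])
  have "(\<lambda>s. L (cis (2 * pi * s))) C1_differentiable_on UNIV"
    unfolding C1_differentiable_on_def
    by (intro exI[of _ "\<lambda>s. L ((2 * pi) *\<^sub>R (\<i> * cis (2 * pi * s)))"] conjI ballI D
        bounded_linear.continuous_on[OF L(1)] continuous_intros)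
  moreover have "vector_derivative (\<lambda>s. L (cis (2 * pi * s))) (at s) \<noteq> 0" for s
    using L(2)[of "(2 * pi) *\<^sub>R (\<i> * cis (2 * pi * s))"] by (auto simp: vector_derivative_at[OF D])
  moreover have "cis (2 * pi * (s + 1)) = cis (2 * pi * s)" for s
    by (simp add: distrib_left flip: cis_mult)
  ultimately show ?thesis by (simp add: regular_closed_curve_def)
qed

lemma range_cis: "range (\<lambda>s. cis (2 * pi * s)) = sphere 0 1"
proof (intro equalityI subsetI)
  fix z :: complex assume "z \<in> sphere 0 1"
  then have z: "norm z = 1" by simp
  then have "z = cis (2 * pi * (Arg z / (2 * pi)))"
    using cis_Arg[of z] by (cases "z = 0") (simp_all add: sgn_div_norm)
  then show "z \<in> range (\<lambda>s. cis (2 * pi * s))" by blast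
qed auto

lemma inj_on_cis: "inj_on (\<lambda>s. cis (2 * pi * s)) {0..<1}"
proof (rule inj_onI)
  fix s u :: real assume s: "s \<in> {0..<1}" and u: "u \<in> {0..<1}" and eq: "cis (2 * pi * s) = cis (2 * pi * u)"
  have "\<i> * (2 * pi * s) = \<i> * (2 * pi * u)"
  proof (rule exp_complex_eqI)
    have "\<bar>s - u\<bar> < 1" using s u by auto
    then have "2 * pi * \<bar>s - u\<bar> < 2 * pi" by simp
    then show "\<bar>Im (\<i> * (2 * pi * s)) - Im (\<i> * (2 * pi * u))\<bar> < 2 * pi"
      by (simp add: abs_mult flip: right_diff_distrib)
    show "exp (\<i> * (2 * pi * s)) = exp (\<i> * (2 * pi * u))" using eq by (simp add: cis_conv_exp)
  qed
  then show "s = u" by simp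
qed

lemma mem_hopf:
  "p \<in> hopf_m \<longleftrightarrow> norm (fst p) = 1 \<and> snd p = 0"
  "p \<in> hopf_l \<longleftrightarrow> norm (snd p) = 1 \<and> fst p = 0"
proof -
  have sq: "(norm z)\<^sup>2 = 1 \<longleftrightarrow> norm z = 1" for z :: complex
    unfolding power2_eq_1_iff using norm_ge_zero[of z] by linarith
  show "p \<in> hopf_m \<longleftrightarrow> norm (fst p) = 1 \<and> snd p = 0"
    by (cases "snd p = 0") (simp_all add: hopf_m_def mem_S3 sq)
  show "p \<in> hopf_l \<longleftrightarrow> norm (snd p) = 1 \<and> fst p = 0"
    by (cases "fst p = 0") (simp_all add: hopf_l_def mem_S3 sq)
qed

lemma hopf_image: "hopf_m = range (\<lambda>s. (cis (2 * pi * s), 0))" "hopf_l = range (\<lambda>s. (0, cis (2 * pi * s)))"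
proof -
  have "p \<in> hopf_m \<longleftrightarrow> p \<in> (\<lambda>z. (z, 0)) ` sphere 0 1" "p \<in> hopf_l \<longleftrightarrow> p \<in> (\<lambda>z. (0, z)) ` sphere 0 1" for p
    by (cases p; auto simp only: mem_hopf mem_sphere_0 image_iff fst_conv snd_conv prod.inject)+
  then have "hopf_m = (\<lambda>z. (z, 0)) ` sphere 0 1" "hopf_l = (\<lambda>z. (0, z)) ` sphere 0 1" by blast+
  then show "hopf_m = range (\<lambda>s. (cis (2 * pi * s), 0))" "hopf_l = range (\<lambda>s. (0, cis (2 * pi * s)))"
    unfolding range_cis[symmetric] by (simp_all only: image_image)
qed

text \<open>One family serves both fixed links: curve 0 is \<open>unknot\<close>, the same set as
  \<open>hopf_m\<close>, and curves 0 and 1 form the Hopf link. Larger indices repeat curve 1,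
  whence the bound \<open>m \<le> 2\<close> below.\<close>

definition great_circles :: "nat \<Rightarrow> real \<Rightarrow> complex \<times> complex" where
  "great_circles j s = (if j = 0 then (cis (2 * pi * s), 0) else (0, cis (2 * pi * s)))"

lemma pseudo_link_param_great_circles:
  assumes "0 < m" "m \<le> 2"
  shows "pseudo_link_param S3 m 0 great_circles (\<lambda>_ _. 0)"
  unfolding pseudo_link_param_def
proof (intro conjI allI impI)
  have L: "bounded_linear (\<lambda>z::complex. (z, 0::complex))" "bounded_linear (\<lambda>z::complex. (0::complex, z))"
    by (intro bounded_linear_Pair bounded_linear_ident bounded_linear_zero)+
  show "regular_closed_curve (great_circles j)" for j
    using regular_closed_curve_cis[OF L(1)] regular_closed_curve_cis[OF L(2)]
    by (cases "j = 0") (simp_all add: great_circles_def[abs_def] prod_eq_iff)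
  show "range (great_circles j) \<subseteq> S3" for j
    by (auto simp: great_circles_def mem_S3)
  have "(i, s) = (j, u)"
    if "i < m" "j < m" "s \<in> {0..<1}" "u \<in> {0..<1}" "great_circles i s = great_circles j u" for i j s u
  proof -
    have ij: "i = 0 \<longleftrightarrow> j = 0" and c: "cis (2 * pi * s) = cis (2 * pi * u)"
      using that(5) by (auto simp: great_circles_def split: if_splits)
    moreover have "i < 2" "j < 2" using that assms by auto
    ultimately have "i = j" by auto
    with inj_onD[OF inj_on_cis c] that show ?thesis by simp
  qed
  then have "inj_on (\<lambda>(j, s). great_circles j s) {(j, s). j < m \<and> s \<in> {0..<1}}"
    by (intro inj_onI, unfold mem_Collect_eq split_paired_all case_prod_conv) blast
  then show "inj_on (\<lambda>(j, s). great_circles j s)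
      {(j, s). j < m \<and> s \<in> {0..<1} \<and> great_circles j s \<notin> (\<lambda>i. 0) ` {..<0::nat}}"
    by simp
qed (use assms in \<open>auto simp: disjoint_family_on_def\<close>)

text \<open>
  A precrossing disc has two independent tangent directions along its strands, while a circle
  has only one.
\<close>

lemma no_cross_in_circle:
  assumes d: "embedded_disc d" and cross: "d ` cross \<subseteq> {p. norm (f p) = 1 \<and> g p = 0}"
    and f: "bounded_linear f" and g: "bounded_linear g"
    and fg: "\<And>p. f p = (0::complex) \<Longrightarrow> g p = (0::complex) \<Longrightarrow> p = 0"
  shows False
proof -
  obtain d' where d': "(d has_derivative blinfun_apply d') (at 0 within cball 0 1)" and inj: "inj (blinfun_apply d')"
    using d unfolding embedded_disc_def by fastforce
  define z where "z = f (d 0)"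
  \<comment> \<open>Along either strand \<open>g\<close> is constantly 0 and the squared norm of
    \<open>f\<close> is constantly 1; these two equations are differentiated at the centre.\<close>
  have tangent: "g (d' v) = 0 \<and> inner z (f (d' v)) = 0" if v: "v = 1 \<or> v = \<i>" for v
  proof -
    have line: "((\<lambda>u. u *\<^sub>R v) has_vector_derivative v) (at 0 within {-1..1})"
      by (auto intro!: derivative_eq_intros)
    have sub: "(\<lambda>u::real. u *\<^sub>R v) ` {-1..1} \<subseteq> cball 0 1" using v by auto
    have dv: "((\<lambda>u. d (u *\<^sub>R v)) has_vector_derivative d' v) (at 0 within {-1..1})"
      using vector_derivative_diff_chain_within[OF line, of d "blinfun_apply d'"] has_derivative_subset[OF d' sub]
      by (simp add: o_def)
    have in_circle: "norm (f (d (u *\<^sub>R v))) = 1" "g (d (u *\<^sub>R v)) = 0" if "u \<in> {-1..1}" for u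
    proof -
      have "u *\<^sub>R v \<in> cross" using v that by (auto simp: cross_def)
      then show "norm (f (d (u *\<^sub>R v))) = 1" "g (d (u *\<^sub>R v)) = 0" using cross by blast+
    qed
    have uniq: "w = w'" if "(h has_vector_derivative w) (at 0 within {-1..1})"
      "(h has_vector_derivative w') (at 0 within {-1..1})" for h :: "real \<Rightarrow> 'z::real_normed_vector" and w w'
      using vector_derivative_unique_within_closed_interval[of "-1" 1 0 h w w'] that by simp
    have "((\<lambda>u. g (d (u *\<^sub>R v))) has_vector_derivative g (d' v)) (at 0 within {-1..1})"
      by (rule bounded_linear.has_vector_derivative[OF g dv])
    moreover have "((\<lambda>u. g (d (u *\<^sub>R v))) has_vector_derivative 0) (at 0 within {-1..1})"
      by (rule has_vector_derivative_transform[OF _ _ has_vector_derivative_const]) (use in_circle in auto)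
    ultimately have "g (d' v) = 0" by (rule uniq)
    have fd: "((\<lambda>u. f (d (u *\<^sub>R v))) has_vector_derivative f (d' v)) (at 0 within {-1..1})"
      by (rule bounded_linear.has_vector_derivative[OF f dv])
    have "((\<lambda>u. inner (f (d (u *\<^sub>R v))) (f (d (u *\<^sub>R v)))) has_vector_derivative
        inner (f (d (0 *\<^sub>R v))) (f (d' v)) + inner (f (d' v)) (f (d (0 *\<^sub>R v)))) (at 0 within {-1..1})"
      by (rule bounded_bilinear.has_vector_derivative[OF bounded_bilinear_inner fd fd])
    moreover have "((\<lambda>u. inner (f (d (u *\<^sub>R v))) (f (d (u *\<^sub>R v)))) has_vector_derivative 0) (at 0 within {-1..1})"
      by (rule has_vector_derivative_transform[OF _ _ has_vector_derivative_const[of 1]])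
        (use in_circle in \<open>auto simp: dot_square_norm\<close>)
    ultimately have "inner (f (d (0 *\<^sub>R v))) (f (d' v)) + inner (f (d' v)) (f (d (0 *\<^sub>R v))) = 0"
      by (rule uniq)
    then have "inner z (f (d' v)) = 0" by (simp add: z_def inner_commute)
    with \<open>g (d' v) = 0\<close> show ?thesis by blast
  qed
  have "0 \<in> cross" by (simp add: cross_def)
  then have "norm z = 1" using cross by (auto simp: z_def)
  \<comment> \<open>In the plane the unit vectors \<open>z\<close> and \<open>\<i> * z\<close> form
    an orthonormal basis.\<close>
  have multiple: "a = inner (\<i> * z) a *\<^sub>R (\<i> * z)" if "inner z a = 0" for a
  proof -
    have z: "Re z * Re z + Im z * Im z = 1"
      using \<open>norm z = 1\<close> by (metis cmod_power2 one_power2 power2_eq_square)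
    have a: "Re z * Re a + Im z * Im a = 0" using that by (simp add: inner_complex_def)
    have "Re a = (Re z * Re z + Im z * Im z) * Re a - Re z * (Re z * Re a + Im z * Im a)"
      "Im a = (Re z * Re z + Im z * Im z) * Im a - Im z * (Re z * Re a + Im z * Im a)"
      unfolding z a by simp_all
    then show ?thesis by (simp add: complex_eq_iff inner_complex_def algebra_simps)
  qed
  define \<alpha> \<beta> where "\<alpha> = inner (\<i> * z) (f (d' 1))" and "\<beta> = inner (\<i> * z) (f (d' \<i>))"
  \<comment> \<open>Both tangent vectors have \<open>f\<close>-part on the line of
    \<open>\<i> * z\<close>, with coefficients \<open>\<alpha>\<close> and \<open>\<beta>\<close>,
    and \<open>w\<close> is the combination in which these cancel. Injectivity of \<open>d'\<close>
    forces \<open>w = 0\<close>, so \<open>\<alpha> = 0\<close> and \<open>d'\<close> would already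
    kill the direction 1.\<close>
  define w where "w = \<beta> *\<^sub>R 1 - \<alpha> *\<^sub>R \<i>"
  interpret f: bounded_linear f by (rule f)
  interpret g: bounded_linear g by (rule g)
  have a: "f (d' 1) = \<alpha> *\<^sub>R (\<i> * z)" and b: "f (d' \<i>) = \<beta> *\<^sub>R (\<i> * z)"
    unfolding \<alpha>_def \<beta>_def using tangent by (intro multiple; simp)+
  have "d' w = \<beta> *\<^sub>R d' 1 - \<alpha> *\<^sub>R d' \<i>" by (simp only: w_def blinfun.diff_right blinfun.scaleR_right)
  then have "f (d' w) = 0" "g (d' w) = 0"
    using tangent by (simp_all add: f.diff f.scaleR g.diff g.scaleR a b)
  then have "d' w = 0" by (rule fg)
  then have "w = 0" using injD[OF inj, of w 0] by simp
  then have "\<alpha> = 0" by (simp add: w_def complex_eq_iff)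
  then have "f (d' 1) = 0" using a by simp
  moreover have "g (d' 1) = 0" using tangent by simp
  ultimately have "d' 1 = 0" by (rule fg)
  then show False using injD[OF inj, of 1 0] by simp
qed

text \<open>Keeps a cross from being shared out between the two disjoint components of the Hopf
  link.\<close>

lemma connected_cross: "connected cross"
proof (rule starlike_imp_connected)
  have "closed_segment 0 z \<subseteq> cross" if "z \<in> cross" for z
  proof
    fix w assume "w \<in> closed_segment 0 z"
    then obtain u where u: "0 \<le> u" "u \<le> 1" "w = u *\<^sub>R z" by (auto simp: in_segment)
    have "norm w \<le> 1" using u that mult_mono[of u 1 "norm z" 1] by (simp add: cross_def)
    then show "w \<in> cross" using u that by (auto simp: cross_def)
  qed
  moreover have "0 \<in> cross" by (simp add: cross_def)
  ultimately show "starlike cross" unfolding starlike_def by blast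
qed

text \<open>The closed sets \<open>?A\<close> and \<open>?B\<close> separate the two circles, so a
  connected cross lies in just one of them. The case of the unknot is included, being
  \<open>hopf_m\<close>.\<close>

lemma no_disc_in_great_circles:
  assumes d: "embedded_disc d"
  shows "\<not> d ` cross \<subseteq> hopf_m \<union> hopf_l"
proof
  assume sub: "d ` cross \<subseteq> hopf_m \<union> hopf_l"
  let ?A = "{p :: complex \<times> complex. snd p = 0}" and ?B = "{p :: complex \<times> complex. fst p = 0}"
  obtain d' :: "complex \<Rightarrow> complex \<Rightarrow>\<^sub>L (complex \<times> complex)" where
    "\<And>z. z \<in> cball 0 1 \<Longrightarrow> (d has_derivative blinfun_apply (d' z)) (at z within cball 0 1)"
    using d unfolding embedded_disc_def by blast
  then have "continuous_on (cball 0 1) d" by (rule has_derivative_continuous_on)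
  then have conn: "connected (d ` cross)"
    by (intro connected_continuous_image connected_cross) (auto simp: cross_def elim: continuous_on_subset)
  have "closed ?A" "closed ?B" by (intro closed_Collect_eq continuous_intros)+
  moreover have "d ` cross \<subseteq> ?A \<union> ?B" using sub mem_hopf by blast
  moreover have "?A \<inter> ?B \<inter> d ` cross = {}" using sub by (auto simp: mem_hopf)
  ultimately consider "?A \<inter> d ` cross = {}" | "?B \<inter> d ` cross = {}"
    using connected_closedD[OF conn, of ?A ?B] by blast
  then show False
  proof cases
    case 1
    then have "d ` cross \<subseteq> {p. norm (snd p) = 1 \<and> fst p = 0}"
      using sub mem_hopf by blast
    then show False
      by (rule no_cross_in_circle[OF d _ bounded_linear_snd bounded_linear_fst]) (simp add: prod_eq_iff)
  next
    case 2
    then have "d ` cross \<subseteq> {p. norm (fst p) = 1 \<and> snd p = 0}"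
      using sub mem_hopf by blast
    then show False
      by (rule no_cross_in_circle[OF d _ bounded_linear_fst bounded_linear_snd]) (simp add: prod_eq_iff)
  qed
qed

section \<open>The unknot and the Hopf link as fixed links\<close>

interpretation unknot: fixed_link "{unknot}" 1 great_circles
proof
  show eq: "{unknot} = (\<lambda>j. range (great_circles j)) ` {..<1}"
    using hopf_image(1) by (simp add: unknot_def hopf_m_def great_circles_def lessThan_Suc)
  show "\<not> d ` cross \<subseteq> \<Union>{unknot}" if "embedded_disc d" for d
    using no_disc_in_great_circles[OF that] by (auto simp: unknot_def hopf_m_def)
qed (simp add: pseudo_link_param_great_circles)

interpretation hopf: fixed_link "{hopf_m, hopf_l}" 2 great_circles
proof
  show eq: "{hopf_m, hopf_l} = (\<lambda>j. range (great_circles j)) ` {..<2}"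
    using hopf_image by (simp add: great_circles_def lessThan_Suc numeral_2_eq_2 insert_commute)
  show "\<not> d ` cross \<subseteq> \<Union>{hopf_m, hopf_l}" if "embedded_disc d" for d
    using no_disc_in_great_circles[OF that] by simp
qed (simp add: pseudo_link_param_great_circles)


section \<open>Pushing links off a neighbourhood of the unknot\<close>

text \<open>\<open>C1_open\<close> asks for full derivatives at the points of a set that may fail to
  be open, which suits explicit formulas making sense around \<open>M\<close>. Time and position are
  treated as one variable; the space derivative is the joint one restricted to vectors
  \<open>(0, v)\<close>.\<close>

lemma C1_embedding_familyI:
  fixes \<Phi> :: "real \<Rightarrow> 'a::euclidean_space \<Rightarrow> 'b::real_normed_vector"
  assumes \<Phi>: "C1_open ({0..1} \<times> M) (\<lambda>x. \<Phi> (fst x) (snd x))"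
    and sub: "\<And>t. t \<in> {0..1} \<Longrightarrow> \<Phi> t ` M \<subseteq> N"
    and inv: "\<And>t x. t \<in> {0..1} \<Longrightarrow> x \<in> M \<Longrightarrow> \<Psi> t (\<Phi> t x) = x"
    and \<Psi>: "\<And>t. t \<in> {0..1} \<Longrightarrow> C1_open (\<Phi> t ` M) (\<Psi> t)"
  shows "C1_embedding_family M N \<Phi>"
proof -
  obtain F' where F': "\<And>x. x \<in> {0..1} \<times> M \<Longrightarrow> ((\<lambda>x. \<Phi> (fst x) (snd x)) has_derivative F' x) (at x)"
    "\<And>v. continuous_on ({0..1} \<times> M) (\<lambda>x. F' x v)"
    using \<Phi> unfolding C1_open_def by blast
  define \<Phi>' where "\<Phi>' t x = Blinfun (\<lambda>v. F' (t, x) (0, v))" for t x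
  have D: "(\<Phi> t has_derivative (\<lambda>v. F' (t, x) (0, v))) (at x)" if "t \<in> {0..1}" "x \<in> M" for t x
  proof -
    have "((\<lambda>x. (t, x)) has_derivative (\<lambda>v. (0, v))) (at x)"
      by (auto intro!: derivative_eq_intros)
    from has_derivative_compose[OF this F'(1)] show ?thesis using that by simp
  qed
  have app: "blinfun_apply (\<Phi>' t x) = (\<lambda>v. F' (t, x) (0, v))" if "t \<in> {0..1}" "x \<in> M" for t x
    unfolding \<Phi>'_def
    by (rule bounded_linear_Blinfun_apply) (rule has_derivative_bounded_linear[OF D[OF that]])
  have D': "(\<Phi> t has_derivative blinfun_apply (\<Phi>' t x)) (at x within M)" if "t \<in> {0..1}" "x \<in> M" for t x
    unfolding app[OF that] by (rule has_derivative_at_withinI[OF D[OF that]])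
  have cont: "continuous_on ({0..1} \<times> M) (\<lambda>(t, x). \<Phi>' t x)"
  proof (rule continuous_on_blinfun_componentwise)
    fix v
    show "continuous_on ({0..1} \<times> M) (\<lambda>p. blinfun_apply (case p of (t, x) \<Rightarrow> \<Phi>' t x) v)"
      by (rule continuous_on_eq[OF F'(2)[of "(0, v)"]]) (auto simp: app)
  qed
  show ?thesis
    unfolding C1_embedding_family_def
  proof (intro conjI ballI exI[of _ \<Phi>'] cont D')
    show "continuous_on ({0..1} \<times> M) (\<lambda>(t, x). \<Phi> t x)"
      using C1_open_continuous_on[OF \<Phi>] by (simp add: split_beta)
    fix t :: real assume t: "t \<in> {0..1}"
    have "continuous_on M (\<lambda>x. (\<lambda>(t, x). \<Phi>' t x) (t, x))"
      by (rule continuous_on_compose2[OF cont]) (use t in \<open>auto intro!: continuous_intros\<close>)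
    moreover have "\<Psi> t differentiable (at (\<Phi> t x) within \<Phi> t ` M)" if "x \<in> M" for x
      using \<Psi>[OF t] that unfolding C1_open_def by (meson differentiable_def has_derivative_at_withinI imageI)
    ultimately show "C1_embedding M N (\<Phi> t)"
      unfolding C1_embedding_def
      by (intro conjI exI[of _ "\<Phi>' t"] exI[of _ "\<Psi> t"] ballI sub[OF t] inv[OF t] D'[OF t]) simp_all
  qed
qed

text \<open>
  With \<open>a = t r\<^sup>2\<close>, the convex combination \<open>a + (1 - a) (norm (snd p))\<^sup>2\<close> of \<open>1\<close> and
  \<open>(norm (snd p))\<^sup>2\<close> is the new value of the latter, which keeps the 3-sphere invariant.
\<close>

definition push :: "real \<Rightarrow> real \<Rightarrow> complex \<times> complex \<Rightarrow> complex \<times> complex" where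
  "push r t p = (sqrt (1 + - (t * r\<^sup>2)) *\<^sub>R fst p,
     (sqrt (t * r\<^sup>2 + (1 + - (t * r\<^sup>2)) * (norm (snd p))\<^sup>2) * inverse (norm (snd p))) *\<^sub>R snd p)"

text \<open>Obtained by solving \<open>N = a + (1 - a) * n\<close> for the old squared norm
  \<open>n\<close>, with \<open>a = t r\<^sup>2\<close>; the directions of both coordinates are
  kept.\<close>

definition pull :: "real \<Rightarrow> real \<Rightarrow> complex \<times> complex \<Rightarrow> complex \<times> complex" where
  "pull r t p = (inverse (sqrt (1 + - (t * r\<^sup>2))) *\<^sub>R fst p,
     (sqrt ((norm (snd p))\<^sup>2 + - (t * r\<^sup>2)) * inverse (sqrt (1 + - (t * r\<^sup>2))) * inverse (norm (snd p))) *\<^sub>R snd p)"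

text \<open>The first two facts keep the square roots in \<open>push\<close> differentiable, the
  fourth and fifth do so for the point-dependent terms of \<open>pull\<close>. At
  \<open>t = 1\<close> the fourth says that the image lies outside the neighbourhood of radius
  \<open>r\<close>, which is why the coefficient is the square of \<open>r\<close>.\<close>

lemma push:
  assumes r: "0 < r" "r < 1" and t: "t \<in> {0..1}" and p: "snd p \<noteq> 0"
  shows "0 < 1 + - (t * r\<^sup>2)" and "0 < t * r\<^sup>2 + (1 + - (t * r\<^sup>2)) * (norm (snd p))\<^sup>2"
    and "(norm (snd (push r t p)))\<^sup>2 = t * r\<^sup>2 + (1 + - (t * r\<^sup>2)) * (norm (snd p))\<^sup>2"
    and "t * r\<^sup>2 < (norm (snd (push r t p)))\<^sup>2" and "snd (push r t p) \<noteq> 0"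
    and "p \<in> S3 \<Longrightarrow> push r t p \<in> S3" and "pull r t (push r t p) = p"
proof -
  have r2: "0 < r\<^sup>2" "r\<^sup>2 < 1" using r by (auto simp: power_less_one_iff)
  have "t * r\<^sup>2 \<le> 1 * r\<^sup>2" using t r2 by (intro mult_right_mono) auto
  then show a: "0 < 1 + - (t * r\<^sup>2)" using r2 by linarith
  define b where "b = (1 + - (t * r\<^sup>2)) * (norm (snd p))\<^sup>2"
  define N where "N = t * r\<^sup>2 + b"
  have b: "0 < b" using a p by (simp add: b_def)
  have "0 \<le> t * r\<^sup>2" using t by simp
  then have N: "0 < N" using b by (simp add: N_def)
  then show "0 < t * r\<^sup>2 + (1 + - (t * r\<^sup>2)) * (norm (snd p))\<^sup>2" by (simp add: N_def b_def)
  have push: "push r t p = (sqrt (1 + - (t * r\<^sup>2)) *\<^sub>R fst p, (sqrt N * inverse (norm (snd p))) *\<^sub>R snd p)"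
    by (simp add: push_def N_def b_def)
  have norm: "norm (snd (push r t p)) = sqrt N" using N p by (simp add: push)
  then have n2: "(norm (snd (push r t p)))\<^sup>2 = N" using N by simp
  then show "(norm (snd (push r t p)))\<^sup>2 = t * r\<^sup>2 + (1 + - (t * r\<^sup>2)) * (norm (snd p))\<^sup>2"
    by (simp add: N_def b_def)
  show "t * r\<^sup>2 < (norm (snd (push r t p)))\<^sup>2" using n2 b by (simp add: N_def)
  show "snd (push r t p) \<noteq> 0" using n2 N by auto
  show "push r t p \<in> S3" if "p \<in> S3"
  proof -
    have "(norm (fst (push r t p)))\<^sup>2 = (1 + - (t * r\<^sup>2)) * (norm (fst p))\<^sup>2"
      using a by (simp add: push power_mult_distrib)
    moreover have "(norm (fst p))\<^sup>2 = 1 - (norm (snd p))\<^sup>2" using that by (simp add: mem_S3)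
    ultimately show ?thesis unfolding mem_S3 n2 N_def b_def by (simp add: algebra_simps)
  qed
  have "sqrt (N + - (t * r\<^sup>2)) = sqrt (1 + - (t * r\<^sup>2)) * norm (snd p)"
    by (simp add: N_def b_def real_sqrt_mult)
  then have "snd (pull r t (push r t p)) =
      (sqrt (1 + - (t * r\<^sup>2)) * norm (snd p) * inverse (sqrt (1 + - (t * r\<^sup>2))) * inverse (sqrt N)) *\<^sub>R snd (push r t p)"
    unfolding pull_def snd_conv n2 by (simp only: norm)
  also have "\<dots> = snd p" using a N p unfolding push snd_conv scaleR_scaleR by (simp add: field_simps)
  finally show "pull r t (push r t p) = p" using a by (simp add: prod_eq_iff) (simp add: pull_def push)
qed

lemma mem_unknot_W: "p \<in> unknot.W \<longleftrightarrow> p \<in> S3 \<and> snd p \<noteq> 0"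
  unfolding unknot.W_def by (auto simp: unknot_def)

lemma C1_embedding_family_push:
  assumes r: "0 < r" "r < 1"
  shows "C1_embedding_family unknot.W unknot.W (push r)"
proof (rule C1_embedding_familyI[where \<Psi> = "pull r"])
  show "C1_open ({0..1} \<times> unknot.W) (\<lambda>x. push r (fst x) (snd x))"
    unfolding push_def
    by (intro C1_open_intros) (use push(1,2)[OF r] in \<open>auto simp: mem_unknot_W\<close>)
  show "push r t ` unknot.W \<subseteq> unknot.W" "\<And>p. p \<in> unknot.W \<Longrightarrow> pull r t (push r t p) = p" if "t \<in> {0..1}" for t
    using push[OF r that] by (auto simp: mem_unknot_W)
  show "C1_open (push r t ` unknot.W) (pull r t)" if t: "t \<in> {0..1}" for t
    unfolding pull_def
    by (intro C1_open_intros) (use push(4,5)[OF r t] in \<open>auto simp: mem_unknot_W\<close>)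
qed

section \<open>The bijections for the solid torus and the thickened torus\<close>

theorem theorem2:
  fixes r :: real
    and h :: "(complex \<times> real) \<times> real \<Rightarrow> complex \<times> complex"
    and g :: "(complex \<times> complex) \<times> real \<Rightarrow> complex \<times> complex"
  assumes "0 < r" and "r < 1"
    and "C1_diffeo int_solid_torus (S3 - unknot_nbhd r) h"
    and "C1_diffeo int_thickened_torus (S3 - (hopf_m \<union> hopf_l)) g"
  shows "bij_betw (class_map (mixed_isotopic {unknot}) (mixed_representation {unknot} h))
           (pseudo_links int_solid_torus // isotopic int_solid_torus)
           (mixed_pseudo_links {unknot} // mixed_isotopic {unknot})
       \<and> bij_betw (class_map (mixed_isotopic {hopf_m, hopf_l}) (mixed_representation {hopf_m, hopf_l} g))
           (pseudo_links int_thickened_torus // isotopic int_thickened_torus)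
           (mixed_pseudo_links {hopf_m, hopf_l} // mixed_isotopic {hopf_m, hopf_l})"
proof
  have Y: "p \<in> S3 - unknot_nbhd r \<longleftrightarrow> p \<in> S3 \<and> r < norm (snd p)" for p
    by (auto simp: unknot_nbhd_def)
  have YW: "S3 - unknot_nbhd r \<subseteq> unknot.W"
    using assms(1) unfolding subset_iff Y mem_unknot_W by auto
  show "bij_betw (class_map (mixed_isotopic {unknot}) (mixed_representation {unknot} h))
           (pseudo_links int_solid_torus // isotopic int_solid_torus)
           (mixed_pseudo_links {unknot} // mixed_isotopic {unknot})"
  proof (rule unknot.bij_betw_mixed_representation[OF assms(3) YW C1_embedding_family_push[OF assms(1,2)]])
    show "push r 0 p = p" if "p \<in> unknot.W" for p
      using that by (simp add: push_def mem_unknot_W prod_eq_iff)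
    show "push r 1 ` unknot.W \<subseteq> S3 - unknot_nbhd r"
    proof (rule image_subsetI)
      fix p assume p: "p \<in> unknot.W"
      note push = push[OF assms(1,2), of 1 p, simplified]
      have "r < norm (snd (push r 1 p))"
        using push(4) p by (intro power_less_imp_less_base[of r 2]) (auto simp: mem_unknot_W)
      then show "push r 1 p \<in> S3 - unknot_nbhd r" using push(6) p unfolding Y mem_unknot_W by simp
    qed
    show "push r t ` (S3 - unknot_nbhd r) \<subseteq> S3 - unknot_nbhd r" if t: "t \<in> {0..1}" for t
    proof (rule image_subsetI)
      fix p assume p: "p \<in> S3 - unknot_nbhd r"
      then have S3: "p \<in> S3" and rp: "r < norm (snd p)" and 0: "snd p \<noteq> 0"
        using assms(1) unfolding Y by auto
      note push = push[OF assms(1,2) t 0]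
      \<comment> \<open>The push raises the squared norm by
        \<open>t * r\<^sup>2 * (1 - (norm (snd p))\<^sup>2)\<close>, which is nonnegative on the
        sphere; so points never approach the unknot.\<close>
      have "(norm (snd p))\<^sup>2 \<le> 1" using S3 zero_le_power2[of "norm (fst p)"] unfolding mem_S3 by linarith
      then have "0 \<le> t * r\<^sup>2 * (1 - (norm (snd p))\<^sup>2)" using t by simp
      then have "(norm (snd p))\<^sup>2 \<le> (norm (snd (push r t p)))\<^sup>2"
        unfolding push(3) by (simp add: algebra_simps)
      then have "norm (snd p) \<le> norm (snd (push r t p))" by (rule power2_le_imp_le) simp
      then show "push r t p \<in> S3 - unknot_nbhd r" using rp push(6)[OF S3] unfolding Y by simp
    qed
  qed
  \<comment> \<open>Here the identification covers the whole complement, so the constant identity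
    family takes the place of the push.\<close>
  have W: "S3 - (hopf_m \<union> hopf_l) = hopf.W" by (simp add: hopf.W_def)
  show "bij_betw (class_map (mixed_isotopic {hopf_m, hopf_l}) (mixed_representation {hopf_m, hopf_l} g))
           (pseudo_links int_thickened_torus // isotopic int_thickened_torus)
           (mixed_pseudo_links {hopf_m, hopf_l} // mixed_isotopic {hopf_m, hopf_l})"
    by (rule hopf.bij_betw_mixed_representation[OF assms(4)[unfolded W] subset_refl
          C1_embedding_family_const[OF C1_embedding_id[OF subset_refl]]]) auto
qed

end
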